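(* The set $\mathcal{B}^N_{\mathrm{hLag}}(v,\rho)$ of vectors of $\rho$-barycenters of hierarchical Laguerre tessellations with $N$ cells of $\rho$-volumes $v$ satisfies $\mathcal{B}^N_{\mathrm{hLag}}(v,\rho)=\overline{\mathcal{B}^N_{\mathrm{Lag}}(v,\rho)}$ (closure in $(\mathbb{R}^d)^N$), and it is exactly the set of extreme points of $$\mathcal{C}_N(v,\rho)=\Big\{B\in(\mathbb{R}^d)^N \;;\; \sum_{i=1}^N v_i\delta_{b_i}\preceq_C\rho\Big\}.$$
   Context: Let $d,N\ge 1$ be integers. $\mathcal{P}_1(\mathbb{R}^d)$ denotes the Borel probability measures on $\mathbb{R}^d$ with finite first moment. $\rho\in\mathcal{P}_1(\mathbb{R}^d)$ is absolutely continuous with respect to Lebesgue measure with bounded density, and $v\in\mathbb{R}_{>0}^N$ satisfies $\sum_i v_i=1$. For $\mu,\nu\in\mathcal{P}_1(\mathbb{R}^d)$, $\mu\preceq_C\nu$ means $\int\varphi\,d\mu\le\int\varphi\,d\nu$ for all convex $\varphi:\mathbb{R}^d\to\mathbb{R}$. Laguerre tessellation with $M$ cells: for pairwise distinct points $y_1,\ldots,y_M\in\mathbb{R}^d$ (generators) and weights $\phi\in\mathbb{R}^M$, the list of cells $L_i=\{x\in\mathbb{R}^d:\langle x,y_i\rangle-\phi_i\ge\langle x,y_j\rangle-\phi_j\ \forall j\ne i\}$, $i=1,\ldots,M$. Hierarchical Laguerre tessellation, defined recursively: every Laguerre tessellation is one; and if $(P_i)_{1\le i\le N'}$ is a hierarchical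 Laguerre tessellation and $(Q_j)_{1\le j\le M}$ is a Laguerre tessellation, then for any $i_0$ the tessellation with $N'+M-1$ cells $P_1,\ldots,P_{i_0-1},P_{i_0}\cap Q_1,\ldots,P_{i_0}\cap Q_M,P_{i_0+1},\ldots,P_{N'}$ is one. The cells may be relabelled by any permutation. $\mathcal{B}^N_{\mathrm{Lag}}(v,\rho)$ (respectively $\mathcal{B}^N_{\mathrm{hLag}}(v,\rho)$) is the set of $B\in(\mathbb{R}^d)^N$ for which there is a Laguerre (respectively hierarchical Laguerre) tessellation $(L_i)_{i=1}^N$ with $\rho(L_i)=v_i$ and $b_i=\frac1{v_i}\int_{L_i}x\,d\rho(x)$ for all $i$. *)

theory Defs
  imports "HOL-Probability.Probability"
begin

definition P1 :: "'a::euclidean_space measure set" where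
  "P1 = {\<mu>. sets \<mu> = sets borel \<and> prob_space \<mu> \<and> integrable \<mu> norm}"

definition has_bounded_density :: "'a::euclidean_space measure \<Rightarrow> bool" where
  "has_bounded_density \<mu> \<longleftrightarrow>
     (\<exists>f C. f \<in> borel_measurable lborel \<and> (\<forall>x. 0 \<le> f x \<and> f x \<le> (C::real)) \<and>
        \<mu> = density lborel (\<lambda>x. ennreal (f x)))"

text \<open>
  A convex function need not be integrable with respect to a measure with finite first moment, and
  the Bochner integral of a non-integrable function is 0.  The convex order is therefore
  stated with the extended integral (positive part minus negative part).  For a convex function
  and a measure in \<^const>\<open>P1\<close> the negative part is integrable, because the function has an affine
  minorant, so the difference is well defined with values in \<open>(-\<infinity>, \<infinity>]\<close>.
\<close>

definition ext_integral :: "'a measure \<Rightarrow> ('a \<Rightarrow> real) \<Rightarrow> ereal" where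
  "ext_integral \<mu> f =
     enn2ereal (\<integral>\<^sup>+ x. ennreal (f x) \<partial>\<mu>) - enn2ereal (\<integral>\<^sup>+ x. ennreal (- f x) \<partial>\<mu>)"

definition convex_order :: "'a::euclidean_space measure \<Rightarrow> 'a measure \<Rightarrow> bool"
    (infix "\<preceq>\<^sub>C" 50) where
  "\<mu> \<preceq>\<^sub>C \<nu> \<longleftrightarrow>
     (\<forall>\<phi>::'a \<Rightarrow> real. convex_on UNIV \<phi> \<longrightarrow> ext_integral \<mu> \<phi> \<le> ext_integral \<nu> \<phi>)"

text \<open>The Borel measure \<open>\<Sum>\<^sub>i v\<^sub>i \<delta>\<^bsub>b\<^sub>i\<^esub>\<close>, as the image under \<open>i \<mapsto> b\<^sub>i\<close> of the
  measure on the index type with weights \<open>v\<^sub>i\<close>.\<close>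

definition weighted_diracs :: "real ^ 'n \<Rightarrow> 'a ^ 'n \<Rightarrow> 'a::euclidean_space measure" where
  "weighted_diracs v B = distr (point_measure UNIV (\<lambda>i. ennreal (v $ i))) borel (\<lambda>i. B $ i)"

lemma emeasure_weighted_diracs:
  assumes "A \<in> sets borel"
  shows "emeasure (weighted_diracs v B) A = (\<Sum>i\<in>UNIV. ennreal (v $ i) * indicator A (B $ i))"
proof -
  have "emeasure (weighted_diracs v B) A
      = emeasure (point_measure UNIV (\<lambda>i. ennreal (v $ i))) ((\<lambda>i. B $ i) -` A)"
    unfolding weighted_diracs_def
    by (subst emeasure_distr) (use assms in \<open>auto simp: space_point_measure\<close>)
  also have "\<dots> = (\<Sum>i\<in>(\<lambda>i. B $ i) -` A. ennreal (v $ i))"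
    by (rule emeasure_point_measure_finite) auto
  also have "\<dots> = (\<Sum>i\<in>UNIV. ennreal (v $ i) * indicator A (B $ i))"
    by (rule sum.mono_neutral_cong_left) (auto simp: indicator_def)
  finally show ?thesis .
qed

definition dominated_barycenters ::
    "real ^ 'n \<Rightarrow> 'a::euclidean_space measure \<Rightarrow> ('a ^ 'n) set" where
  "dominated_barycenters v \<rho> = {B. weighted_diracs v B \<preceq>\<^sub>C \<rho>}"

definition laguerre_cell ::
    "'i set \<Rightarrow> ('i \<Rightarrow> 'a) \<Rightarrow> ('i \<Rightarrow> real) \<Rightarrow> 'i \<Rightarrow> 'a::euclidean_space set" where
  "laguerre_cell I y \<phi> i = {x. \<forall>j\<in>I. j \<noteq> i \<longrightarrow> x \<bullet> y i - \<phi> i \<ge> x \<bullet> y j - \<phi> j}"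

definition laguerre_tessellation :: "'i set \<Rightarrow> ('i \<Rightarrow> 'a::euclidean_space set) \<Rightarrow> bool" where
  "laguerre_tessellation I L \<longleftrightarrow>
     (\<exists>y \<phi>. inj_on y I \<and> (\<forall>i\<in>I. L i = laguerre_cell I y \<phi> i))"

text \<open>
  The number of cells changes along the recursion, so the recursive construction is carried out on
  nonempty lists of cells; the labelling of the cells by the index type, in an arbitrary order, is
  added afterwards.
\<close>

inductive hierarchical_cells :: "'a::euclidean_space set list \<Rightarrow> bool" where
  laguerre: "Qs \<noteq> [] \<Longrightarrow> laguerre_tessellation {..<length Qs} (\<lambda>j. Qs ! j) \<Longrightarrow>
    hierarchical_cells Qs"
| refine: "hierarchical_cells Ps \<Longrightarrow> i < length Ps \<Longrightarrow>
    Qs \<noteq> [] \<Longrightarrow> laguerre_tessellation {..<length Qs} (\<lambda>j. Qs ! j) \<Longrightarrow>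
    hierarchical_cells (take i Ps @ map (\<lambda>Q. Ps ! i \<inter> Q) Qs @ drop (Suc i) Ps)"

definition hierarchical_laguerre_tessellation ::
    "('n::finite \<Rightarrow> 'a::euclidean_space set) \<Rightarrow> bool" where
  "hierarchical_laguerre_tessellation L \<longleftrightarrow>
     (\<exists>Ps \<sigma>. hierarchical_cells Ps \<and> bij_betw \<sigma> UNIV {..<length Ps} \<and> (\<forall>i. L i = Ps ! \<sigma> i))"

definition has_volumes_barycenters ::
    "real ^ 'n \<Rightarrow> 'a::euclidean_space measure \<Rightarrow> ('n \<Rightarrow> 'a set) \<Rightarrow> 'a ^ 'n \<Rightarrow> bool" where
  "has_volumes_barycenters v \<rho> L B \<longleftrightarrow>
     (\<forall>i. measure \<rho> (L i) = v $ i \<and> B $ i = (1 / v $ i) *\<^sub>R (LINT x:L i|\<rho>. x))"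

definition B_Lag :: "real ^ 'n \<Rightarrow> 'a::euclidean_space measure \<Rightarrow> ('a ^ 'n) set" where
  "B_Lag v \<rho> = {B. \<exists>L. laguerre_tessellation UNIV L \<and> has_volumes_barycenters v \<rho> L B}"

definition B_hLag :: "real ^ 'n \<Rightarrow> 'a::euclidean_space measure \<Rightarrow> ('a ^ 'n) set" where
  "B_hLag v \<rho> =
     {B. \<exists>L. hierarchical_laguerre_tessellation L \<and> has_volumes_barycenters v \<rho> L B}"

end

theory Submission
  imports Defs
begin

text \<open>
  Testing the convex order with the maximum of the affine functions \<open>x \<bullet> y\<^sub>i - \<phi>\<^sub>i\<close> shows that
  \<open>B \<mapsto> \<Sum>\<^sub>i v\<^sub>i (b\<^sub>i \<bullet> y\<^sub>i)\<close> is maximised over \<open>\<C>\<^sub>N\<close> by the barycenters of a Laguerre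
  tessellation with generators \<open>y\<close>. Perturbing the affine functions by arbitrary convex ones and
  differentiating, every maximiser (also when several \<open>b\<^sub>i\<close> share a generator) satisfies the
  convex order on each cell separately; this replaces Strassen's coupling theorem.
  Hierarchical tessellations thus select faces of faces, down to a single extreme point.

  Since the linear forms with distinct \<open>y\<^sub>i\<close> are dense, \<open>\<C>\<^sub>N\<close> is the convex hull of the closure
  of the Laguerre barycenters, so this closure contains all extreme points. Finally, a limit of
  Laguerre tessellations is hierarchical: after normalising the generators, those that share a
  limit subdivide a single limit cell, and one argues by induction on the number of cells.
\<close>

section \<open>Convex functions and maxima of affine functions\<close>

text \<open>The statement follows from a cycle of inclusions: limits of Laguerre barycenters are
  hierarchical, hierarchical barycenters are extreme, extreme points are limits. In the limit step
  the obstacle is that generators and weights may diverge or degenerate. Cells do not change when a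
  common affine function is subtracted and everything is scaled by a common positive factor; this
  puts one generator at 0 and makes the norms sum to 1. Hence the generators stay bounded and cannot
  all collapse to one point, which makes the induction on the number of cells possible. The weights
  stay bounded because each cell carries mass at least min v_i and so meets a fixed ball. For
  extremality, a point strictly inside a segment is split along the hierarchy, and dominance on the
  current cell must be carried along for both endpoints, since each further split uses both. Cells
  are closed and overlap on their boundaries; as \<rho> does not charge hyperplanes, almost every
  point has a unique maximal affine function, and all partition arguments are made at such
  points.\<close>

lemma convex_on_Max:
  fixes f :: "'i \<Rightarrow> 'a::real_vector \<Rightarrow> real"
  assumes "finite I" "I \<noteq> {}" and conv: "\<And>i. i \<in> I \<Longrightarrow> convex_on S (f i)"
  shows "convex_on S (\<lambda>x. Max ((\<lambda>i. f i x) ` I))"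
proof (rule convex_onI)
  show "convex S"
    using assms convex_on_imp_convex by blast
  fix t :: real and x y
  assume t: "0 < t" "t < 1" and xy: "x \<in> S" "y \<in> S"
  have "f i ((1 - t) *\<^sub>R x + t *\<^sub>R y)
      \<le> (1 - t) * Max ((\<lambda>i. f i x) ` I) + t * Max ((\<lambda>i. f i y) ` I)" if i: "i \<in> I" for i
  proof -
    have "f i ((1 - t) *\<^sub>R x + t *\<^sub>R y) \<le> (1 - t) * f i x + t * f i y"
      using convex_onD[OF conv[OF i]] t xy by simp
    also have "\<dots> \<le> (1 - t) * Max ((\<lambda>i. f i x) ` I) + t * Max ((\<lambda>i. f i y) ` I)"
      using t assms(1) i by (intro add_mono mult_left_mono Max_ge) auto
    finally show ?thesis .
  qed
  then show "Max ((\<lambda>i. f i ((1 - t) *\<^sub>R x + t *\<^sub>R y)) ` I)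
      \<le> (1 - t) * Max ((\<lambda>i. f i x) ` I) + t * Max ((\<lambda>i. f i y) ` I)"
    using assms(1,2) by simp
qed

lemma convex_on_inner_right: "convex_on UNIV (\<lambda>x::'a::real_inner. x \<bullet> a - c)"
  by (rule convex_onI) (auto simp: inner_add_left algebra_simps)

text \<open>Lipschitz bound for the maximum. It dominates the difference quotients below and gives
  continuity of the functional that is minimised to prescribe volumes.\<close>

lemma abs_Max_diff_le:
  fixes f g :: "'i \<Rightarrow> real"
  assumes "finite I" "I \<noteq> {}"
  shows "\<bar>Max (f ` I) - Max (g ` I)\<bar> \<le> (\<Sum>i\<in>I. \<bar>f i - g i\<bar>)"
proof -
  have *: "Max (f ` I) \<le> Max (g ` I) + (\<Sum>i\<in>I. \<bar>f i - g i\<bar>)" for f g :: "'i \<Rightarrow> real"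
  proof -
    have "f i \<le> Max (g ` I) + (\<Sum>i\<in>I. \<bar>f i - g i\<bar>)" if i: "i \<in> I" for i
    proof -
      have "\<bar>f i - g i\<bar> \<le> (\<Sum>i\<in>I. \<bar>f i - g i\<bar>)"
        using assms i by (intro member_le_sum) auto
      moreover have "g i \<le> Max (g ` I)"
        using assms i by auto
      ultimately show ?thesis by linarith
    qed
    then show ?thesis using assms by simp
  qed
  show ?thesis
    using *[of f g] *[of g f] by (simp add: abs_minus_commute)
qed

lemma abs_Max_le:
  fixes f :: "'i \<Rightarrow> real"
  assumes "finite I" "I \<noteq> {}"
  shows "\<bar>Max (f ` I)\<bar> \<le> (\<Sum>i\<in>I. \<bar>f i\<bar>)"
proof -
  have "Max (f ` I) \<in> f ` I" using assms by simp
  then obtain i where "i \<in> I" "Max (f ` I) = f i" by auto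
  then show ?thesis
    using assms member_le_sum[of i I "\<lambda>i. \<bar>f i\<bar>"] by simp
qed

lemma integrable_Max:
  fixes f :: "'i \<Rightarrow> 'a \<Rightarrow> real"
  assumes "finite I" "I \<noteq> {}" "\<And>i. i \<in> I \<Longrightarrow> integrable M (f i)"
  shows "integrable M (\<lambda>x. Max ((\<lambda>i. f i x) ` I))"
proof (rule Bochner_Integration.integrable_bound)
  show "integrable M (\<lambda>x. \<Sum>i\<in>I. \<bar>f i x\<bar>)"
    using assms by auto
  show "(\<lambda>x. Max ((\<lambda>i. f i x) ` I)) \<in> borel_measurable M"
    using assms by (intro borel_measurable_Max) auto
  show "AE x in M. norm (Max ((\<lambda>i. f i x) ` I)) \<le> norm (\<Sum>i\<in>I. \<bar>f i x\<bar>)"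
    using abs_Max_le[OF assms(1,2)] by (intro AE_I2) (simp add: sum_nonneg)
qed

text \<open>A hyperplane separates the open vertical ray below \<open>(b, f b)\<close> from the
  epigraph; its normal \<open>(p, q)\<close> has \<open>q > 0\<close>, so it is the graph of a
  supporting affine function.\<close>

lemma convex_on_subgradient:
  fixes f :: "'a::euclidean_space \<Rightarrow> real"
  assumes "convex_on UNIV f"
  obtains p where "\<And>x. f b + (x - b) \<bullet> p \<le> f x"
proof -
  define S where "S = {b} \<times> {..<f b}"
  define T where "T = epigraph UNIV f"
  have "convex S" unfolding S_def by (intro convex_Times) auto
  moreover have "convex T" unfolding T_def using assms by (rule convex_epigraphI)
  moreover have "S \<noteq> {}" "T \<noteq> {}"
    unfolding S_def T_def epigraph_def by (auto simp: lessThan_def intro: exI[of _ "f b - 1"])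
  moreover have "S \<inter> T = {}" unfolding S_def T_def epigraph_def by auto
  ultimately obtain a c where a: "a \<noteq> 0" "\<forall>z\<in>S. a \<bullet> z \<le> c" "\<forall>z\<in>T. c \<le> a \<bullet> z"
    using separating_hyperplane_sets[of S T] by auto
  obtain p q where pq: "a = (p, q)" by (cases a)
  have S: "p \<bullet> b + q * t \<le> c" if "t < f b" for t
    using a(2) that unfolding pq S_def by auto
  have T: "c \<le> p \<bullet> x + q * t" if "f x \<le> t" for x t
    using a(3) that unfolding pq T_def epigraph_def by auto
  have q0: "q \<ge> 0"
    using S[of "f b - 1"] T[of b "f b"] by (simp add: algebra_simps)
  \<comment> \<open>The ray stops strictly below \<open>f b\<close>, so the height
    \<open>f b\<close> is reached up to an error. Dividing by \<open>q + 1\<close> rather than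
    \<open>q\<close> covers the case \<open>q = 0\<close>, not yet excluded.\<close>
  have key: "p \<bullet> b + q * f b \<le> p \<bullet> x + q * f x" for x
  proof (rule field_le_epsilon)
    fix e :: real assume "0 < e"
    have "q * (e / (q + 1)) \<le> e" using q0 \<open>0 < e\<close> by (simp add: field_simps)
    moreover have "e / (q + 1) > 0" using q0 \<open>0 < e\<close> by simp
    then have "p \<bullet> b + q * (f b - e / (q + 1)) \<le> p \<bullet> x + q * f x"
      using S[of "f b - e / (q + 1)"] T[of x "f x"] by simp
    ultimately show "p \<bullet> b + q * f b \<le> p \<bullet> x + q * f x + e"
      by (simp add: algebra_simps)
  qed
  \<comment> \<open>A vertical hyperplane would make the linear form \<open>p\<close> minimal at
    \<open>b\<close>; the point \<open>b - p\<close> contradicts this.\<close>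
  have "q \<noteq> 0"
  proof
    assume "q = 0"
    then have "p \<bullet> p \<le> 0" using key[of "b - p"] by (simp add: inner_diff_right)
    moreover have "p \<noteq> 0" using a(1) \<open>q = 0\<close> pq by (simp add: zero_prod_def)
    ultimately show False by (metis inner_gt_zero_iff not_le)
  qed
  then have q: "q > 0" using q0 by simp
  show thesis
  proof (rule that[of "- (p /\<^sub>R q)"])
    fix x
    have "q * ((x - b) \<bullet> (- (p /\<^sub>R q))) = p \<bullet> b - p \<bullet> x"
      using q by (simp add: inner_diff_right inner_commute[of _ p] field_simps)
    then have "q * (f b + (x - b) \<bullet> (- (p /\<^sub>R q))) \<le> q * f x"
      using key[of x] by (simp add: algebra_simps)
    then show "f b + (x - b) \<bullet> (- (p /\<^sub>R q)) \<le> f x"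
      using q by simp
  qed
qed

section \<open>Generic points of Laguerre tessellations\<close>

text \<open>Without ties the maximiser is unique, so at such points the closed, overlapping cells
  behave like a partition. The strict gap is what survives small perturbations.\<close>

lemma generic_cell:
  fixes x :: "'a::euclidean_space"
  assumes "finite I" "I \<noteq> {}"
    and gen: "\<forall>i\<in>I. \<forall>j\<in>I. i \<noteq> j \<longrightarrow> x \<bullet> y i - \<phi> i \<noteq> x \<bullet> y j - \<phi> j"
  shows "\<exists>i\<in>I. (\<forall>j\<in>I. x \<in> laguerre_cell I y \<phi> j \<longleftrightarrow> j = i) \<and>
    (\<forall>j\<in>I. j \<noteq> i \<longrightarrow> x \<bullet> y j - \<phi> j < x \<bullet> y i - \<phi> i)"
proof -
  have "Max ((\<lambda>i. x \<bullet> y i - \<phi> i) ` I) \<in> (\<lambda>i. x \<bullet> y i - \<phi> i) ` I"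
    using assms(1,2) by simp
  then obtain i where "i \<in> I" "Max ((\<lambda>i. x \<bullet> y i - \<phi> i) ` I) = x \<bullet> y i - \<phi> i"
    by auto
  then have i: "i \<in> I" "\<forall>j\<in>I. x \<bullet> y j - \<phi> j \<le> x \<bullet> y i - \<phi> i"
    using Max_ge[of "(\<lambda>i. x \<bullet> y i - \<phi> i) ` I"] assms(1) by auto
  have strict: "x \<bullet> y j - \<phi> j < x \<bullet> y i - \<phi> i" if "j \<in> I" "j \<noteq> i" for j
    using i gen that by (metis order_le_less)
  then have "x \<in> laguerre_cell I y \<phi> j \<longleftrightarrow> j = i" if "j \<in> I" for j
    using i(1) that unfolding laguerre_cell_def by fastforce
  then show ?thesis using i(1) strict by blast
qed

lemma closed_laguerre_cell: "closed (laguerre_cell I y \<phi> i)"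
proof -
  have "laguerre_cell I y \<phi> i = (\<Inter>j\<in>I - {i}. {x. x \<bullet> y j - \<phi> j \<le> x \<bullet> y i - \<phi> i})"
    unfolding laguerre_cell_def by auto
  then show ?thesis
    by (auto intro!: closed_INT closed_Collect_le continuous_intros)
qed

lemma laguerre_cell_borel [measurable]: "laguerre_cell I y \<phi> i \<in> sets borel"
  using closed_laguerre_cell by (rule borel_closed)

lemma Max_on_laguerre_cell:
  assumes "finite I" "i \<in> I" "x \<in> laguerre_cell I y \<phi> i"
  shows "Max ((\<lambda>i. x \<bullet> y i - \<phi> i) ` I) = x \<bullet> y i - \<phi> i"
  using assms unfolding laguerre_cell_def by (intro Max_eqI) auto

text \<open>The form in which the density enters: for distinct generators, the set where two affine
  functions agree is a null hyperplane.\<close>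

locale hyperplane_null_measure = prob_space \<rho> for \<rho> :: "'a::euclidean_space measure" +
  assumes sets_borel [measurable_cong, simp]: "sets \<rho> = sets borel"
    and integrable_ident [simp, intro]: "integrable \<rho> (\<lambda>x. x)"
    and AE_hyperplane: "a \<noteq> 0 \<Longrightarrow> AE x in \<rho>. x \<bullet> a \<noteq> c"
begin

lemma space_UNIV [simp]: "space \<rho> = UNIV"
  using sets_eq_imp_space_eq[OF sets_borel] by simp

lemma prob_UNIV [simp]: "prob UNIV = 1"
  using prob_space by simp

lemma integrable_inner [simp, intro]: "integrable \<rho> (\<lambda>x. x \<bullet> a)"
  by (intro integrable_inner_left) auto

lemma set_integrable_borel:
  fixes f :: "'a \<Rightarrow> 'b::{banach, second_countable_topology}"
  assumes "integrable \<rho> f" "A \<in> sets borel"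
  shows "set_integrable \<rho> A f"
  using assms unfolding set_integrable_def by (intro integrable_mult_indicator) auto

lemma AE_generic:
  assumes "finite I" "inj_on y I"
  shows "AE x in \<rho>. \<forall>i\<in>I. \<forall>j\<in>I. i \<noteq> j \<longrightarrow> x \<bullet> y i - \<phi> i \<noteq> x \<bullet> y j - \<phi> j"
proof (intro AE_finite_allI assms(1))
  fix i j assume ij: "i \<in> I" "j \<in> I"
  show "AE x in \<rho>. i \<noteq> j \<longrightarrow> x \<bullet> y i - \<phi> i \<noteq> x \<bullet> y j - \<phi> j"
  proof (cases "i = j")
    case False
    then have "y i - y j \<noteq> 0" using assms(2) ij by (auto dest: inj_onD)
    from AE_hyperplane[OF this, of "\<phi> i - \<phi> j"] show ?thesis
      by eventually_elim (auto simp: inner_diff_right)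
  qed simp
qed

lemma set_integral_split_cells:
  fixes f :: "'a \<Rightarrow> 'b::{banach, second_countable_topology}"
  assumes "finite I" "I \<noteq> {}" "inj_on y I" and f: "integrable \<rho> f" and A: "A \<in> sets borel"
  shows "(LINT x:A|\<rho>. f x) = (\<Sum>i\<in>I. LINT x:A \<inter> laguerre_cell I y \<phi> i|\<rho>. f x)"
proof -
  have "(\<Sum>i\<in>I. LINT x:A \<inter> laguerre_cell I y \<phi> i|\<rho>. f x)
      = (LINT x|\<rho>. (\<Sum>i\<in>I. indicator (A \<inter> laguerre_cell I y \<phi> i) x *\<^sub>R f x))"
    unfolding set_lebesgue_integral_def
    using set_integrable_borel[OF f] A
    by (intro Bochner_Integration.integral_sum[symmetric]) (auto simp: set_integrable_def)
  also have "\<dots> = (LINT x:A|\<rho>. f x)"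
    unfolding set_lebesgue_integral_def
  proof (rule integral_cong_AE)
    show "AE x in \<rho>. (\<Sum>i\<in>I. indicator (A \<inter> laguerre_cell I y \<phi> i) x *\<^sub>R f x)
        = indicator A x *\<^sub>R f x"
      using AE_generic[OF assms(1,3), of \<phi>]
    proof eventually_elim
      case (elim x)
      obtain i where i: "i \<in> I" "\<And>j. j \<in> I \<Longrightarrow> x \<in> laguerre_cell I y \<phi> j \<longleftrightarrow> j = i"
        using generic_cell[OF assms(1,2) elim] by blast
      have "(\<Sum>j\<in>I. indicator (A \<inter> laguerre_cell I y \<phi> j) x *\<^sub>R f x)
          = (\<Sum>j\<in>I. if j = i then indicator A x *\<^sub>R f x else 0)"
        using i by (intro sum.cong) (auto simp: indicator_def)
      then show ?case using assms(1) i(1) by simp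
    qed
  qed (use f A in \<open>auto intro!: borel_measurable_sum borel_measurable_scaleR borel_measurable_indicator\<close>)
  finally show ?thesis by simp
qed

text \<open>
  The right derivative at \<open>t = 0\<close> of the integral of the maximum of the functions
  \<open>x \<bullet> y i - \<phi> i + t * \<psi> i x\<close> is \<open>\<Sum>i. LINT x:A \<inter> L i|\<rho>. \<psi> i x\<close>: at a generic point the
  maximiser does not change for small \<open>t\<close>.
\<close>

lemma le_derivative_of_Max:
  fixes \<psi> :: "'i \<Rightarrow> 'a \<Rightarrow> real"
  assumes I: "finite I" "I \<noteq> {}" "inj_on y I" and A: "A \<in> sets borel"
    and \<psi>: "\<And>i. i \<in> I \<Longrightarrow> integrable \<rho> (\<psi> i)"
    and le: "\<And>t. 0 < t \<Longrightarrow> (LINT x:A|\<rho>. Max ((\<lambda>i. x \<bullet> y i - \<phi> i) ` I)) + t * c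
      \<le> (LINT x:A|\<rho>. Max ((\<lambda>i. x \<bullet> y i - \<phi> i + t * \<psi> i x) ` I))"
  shows "c \<le> (\<Sum>i\<in>I. LINT x:A \<inter> laguerre_cell I y \<phi> i|\<rho>. \<psi> i x)"
proof -
  define t where "t n = 1 / real (Suc n)" for n
  have t: "t n > 0" for n unfolding t_def by simp
  have t0: "t \<longlonglongrightarrow> 0" unfolding t_def by (rule LIMSEQ_Suc, rule lim_1_over_n)
  define m where "m s x = Max ((\<lambda>i. x \<bullet> y i - \<phi> i + s * \<psi> i x) ` I)" for s x
  have m_int: "integrable \<rho> (m s)" for s
    unfolding m_def using I \<psi> by (intro integrable_Max) auto
  define D where "D n x = (m (t n) x - m 0 x) / t n" for n x
  define E where "E x = (\<Sum>i\<in>I. indicator (laguerre_cell I y \<phi> i) x * \<psi> i x)" for x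
  have E_int: "integrable \<rho> E"
    unfolding E_def using set_integrable_borel[OF \<psi>]
    by (intro Bochner_Integration.integrable_sum) (auto simp: set_integrable_def)
  note [measurable] = borel_measurable_integrable[OF m_int] borel_measurable_integrable[OF E_int] A
  \<comment> \<open>Dominated convergence: the maximum is Lipschitz, which bounds the quotients
    uniformly in \<open>n\<close>, and at a generic point the strict gap makes them eventually equal
    to \<open>\<psi> i x\<close>.\<close>
  have lim: "(\<lambda>n. LINT x|\<rho>. indicator A x *\<^sub>R D n x) \<longlonglongrightarrow> (LINT x|\<rho>. indicator A x *\<^sub>R E x)"
  proof (rule integral_dominated_convergence[where w = "\<lambda>x. \<Sum>i\<in>I. \<bar>\<psi> i x\<bar>"])
    show "(\<lambda>x. indicator A x *\<^sub>R E x) \<in> borel_measurable \<rho>"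
      by measurable
    show "(\<lambda>x. indicator A x *\<^sub>R D n x) \<in> borel_measurable \<rho>" for n
      unfolding D_def by measurable
    show "integrable \<rho> (\<lambda>x. \<Sum>i\<in>I. \<bar>\<psi> i x\<bar>)" using \<psi> by auto
    show "AE x in \<rho>. norm (indicator A x *\<^sub>R D n x) \<le> (\<Sum>i\<in>I. \<bar>\<psi> i x\<bar>)" for n
    proof (intro AE_I2)
      fix x
      have "\<bar>m (t n) x - m 0 x\<bar> \<le> (\<Sum>i\<in>I. \<bar>t n * \<psi> i x\<bar>)"
        unfolding m_def using abs_Max_diff_le[OF I(1,2), of "\<lambda>i. x \<bullet> y i - \<phi> i + t n * \<psi> i x"
          "\<lambda>i. x \<bullet> y i - \<phi> i + 0 * \<psi> i x"] by simp
      also have "\<dots> = t n * (\<Sum>i\<in>I. \<bar>\<psi> i x\<bar>)"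
        using t[of n] by (simp add: sum_distrib_left abs_mult)
      finally have "\<bar>D n x\<bar> \<le> (\<Sum>i\<in>I. \<bar>\<psi> i x\<bar>)"
        unfolding D_def using t[of n] by (simp add: divide_le_eq mult.commute)
      then show "norm (indicator A x *\<^sub>R D n x) \<le> (\<Sum>i\<in>I. \<bar>\<psi> i x\<bar>)"
        by (auto simp: indicator_def sum_nonneg)
    qed
    show "AE x in \<rho>. (\<lambda>n. indicator A x *\<^sub>R D n x) \<longlonglongrightarrow> indicator A x *\<^sub>R E x"
      using AE_generic[OF I(1,3), of \<phi>]
    proof eventually_elim
      case (elim x)
      obtain i where i: "i \<in> I" "\<And>j. j \<in> I \<Longrightarrow> x \<in> laguerre_cell I y \<phi> j \<longleftrightarrow> j = i"
        "\<And>j. j \<in> I \<Longrightarrow> j \<noteq> i \<Longrightarrow> x \<bullet> y j - \<phi> j < x \<bullet> y i - \<phi> i"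
        using generic_cell[OF I(1,2) elim] by blast
      have "E x = (\<Sum>j\<in>I. if j = i then \<psi> i x else 0)"
        unfolding E_def using i(1,2) by (intro sum.cong) (auto simp: indicator_def)
      then have E: "E x = \<psi> i x" using I(1) i(1) by simp
      have ev: "\<forall>\<^sub>F n in sequentially.
          x \<bullet> y j - \<phi> j + t n * \<psi> j x \<le> x \<bullet> y i - \<phi> i + t n * \<psi> i x" if j: "j \<in> I" for j
      proof (cases "j = i")
        case False
        have "(\<lambda>n. x \<bullet> y j - \<phi> j + t n * \<psi> j x) \<longlonglongrightarrow> x \<bullet> y j - \<phi> j + 0 * \<psi> j x"
          "(\<lambda>n. x \<bullet> y i - \<phi> i + t n * \<psi> i x) \<longlonglongrightarrow> x \<bullet> y i - \<phi> i + 0 * \<psi> i x"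
          by (intro tendsto_intros t0)+
        from order_tendstoD(2)[OF tendsto_diff[OF this], of 0] i(3)[OF j False]
        show ?thesis by (auto elim: eventually_mono)
      qed simp
      have "\<forall>\<^sub>F n in sequentially. \<forall>j\<in>I.
          x \<bullet> y j - \<phi> j + t n * \<psi> j x \<le> x \<bullet> y i - \<phi> i + t n * \<psi> i x"
        using ev I(1) by (simp add: eventually_ball_finite_distrib)
      then have "\<forall>\<^sub>F n in sequentially. D n x = \<psi> i x"
      proof eventually_elim
        case (elim n)
        have "m (t n) x = x \<bullet> y i - \<phi> i + t n * \<psi> i x"
          unfolding m_def using elim i(1) I(1) by (intro Max_eqI) auto
        moreover have "m 0 x = x \<bullet> y i - \<phi> i"
          unfolding m_def using Max_on_laguerre_cell[OF I(1) i(1), of x y \<phi>] i(1,2) by simp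
        ultimately show ?case unfolding D_def using t[of n] by simp
      qed
      then have "(\<lambda>n. D n x) \<longlonglongrightarrow> \<psi> i x" by (rule tendsto_eventually)
      then show ?case unfolding E by (intro tendsto_intros)
    qed
  qed
  have "c \<le> (LINT x|\<rho>. indicator A x *\<^sub>R D n x)" for n
  proof -
    have "(LINT x:A|\<rho>. m 0 x) + t n * c \<le> (LINT x:A|\<rho>. m (t n) x)"
      using le[OF t] unfolding m_def by simp
    then have "t n * c \<le> (LINT x:A|\<rho>. m (t n) x - m 0 x)"
      using m_int A by (subst set_integral_diff) (auto intro!: set_integrable_borel)
    also have "\<dots> = (LINT x|\<rho>. t n * (indicator A x *\<^sub>R D n x))"
      unfolding set_lebesgue_integral_def D_def using t[of n]
      by (intro Bochner_Integration.integral_cong) auto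
    also have "\<dots> = t n * (LINT x|\<rho>. indicator A x *\<^sub>R D n x)" by simp
    finally show ?thesis using t[of n] by simp
  qed
  then have "c \<le> (LINT x|\<rho>. indicator A x *\<^sub>R E x)"
    using lim by (intro LIMSEQ_le_const) auto
  also have "\<dots> = (\<Sum>i\<in>I. LINT x:A \<inter> laguerre_cell I y \<phi> i|\<rho>. \<psi> i x)"
  proof -
    have "(LINT x|\<rho>. indicator A x *\<^sub>R E x)
        = (LINT x|\<rho>. (\<Sum>i\<in>I. indicator (A \<inter> laguerre_cell I y \<phi> i) x *\<^sub>R \<psi> i x))"
      unfolding E_def
      by (intro Bochner_Integration.integral_cong) (auto simp: sum_distrib_left indicator_def intro!: sum.cong)
    also have "\<dots> = (\<Sum>i\<in>I. LINT x:A \<inter> laguerre_cell I y \<phi> i|\<rho>. \<psi> i x)"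
      unfolding set_lebesgue_integral_def
      using set_integrable_borel[OF \<psi>] A
      by (intro Bochner_Integration.integral_sum) (auto simp: set_integrable_def)
    finally show ?thesis .
  qed
  finally show ?thesis .
qed

end

section \<open>Faces cut out by Laguerre tessellations\<close>

lemma sum_Union_disjoint_list:
  assumes "sorted_wrt (\<lambda>A B. A \<inter> B = {}) Js" "\<And>J. J \<in> set Js \<Longrightarrow> finite J"
  shows "(\<Sum>i\<in>\<Union>(set Js). f i) = (\<Sum>k<length Js. \<Sum>i\<in>Js ! k. f i)"
proof -
  have "\<Union>(set Js) = (\<Union>k\<in>{..<length Js}. Js ! k)"
    by (auto simp: set_conv_nth)
  moreover have "Js ! k \<inter> Js ! l = {}" if "k < length Js" "l < length Js" "k \<noteq> l" for k l
  proof (cases "k < l")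
    case False
    then show ?thesis using assms(1) that sorted_wrt_nth_less[of _ Js l k] by force
  qed (use assms(1) that sorted_wrt_nth_less[of _ Js k l] in force)
  ultimately show ?thesis
    using assms(2) by (simp add: sum.UNION_disjoint)
qed

lemma hierarchical_cells_closed:
  assumes "hierarchical_cells Ps" "P \<in> set Ps"
  shows "closed P"
proof -
  have lag: "closed Q" if "laguerre_tessellation {..<length Qs} (\<lambda>j. Qs ! j)" "Q \<in> set Qs"
    for Q :: "'a set" and Qs
    using that closed_laguerre_cell
    by (auto simp: laguerre_tessellation_def in_set_conv_nth)
  show ?thesis
    using assms
  proof (induction arbitrary: P)
    case (laguerre Qs)
    then show ?case using lag by blast
  next
    case (refine Ps i Qs)
    then show ?case
      using lag nth_mem[OF refine.hyps(2)]
      by (auto dest!: in_set_takeD in_set_dropD intro!: closed_Int)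
  qed
qed

lemma hierarchical_cells_borel:
  "hierarchical_cells Ps \<Longrightarrow> P \<in> set Ps \<Longrightarrow> P \<in> sets borel"
  by (intro borel_closed hierarchical_cells_closed)

context hyperplane_null_measure
begin

lemma set_integral_laguerre_list:
  fixes f :: "'a \<Rightarrow> 'b::{banach, second_countable_topology}"
  assumes "laguerre_tessellation {..<length Qs} (\<lambda>j. Qs ! j)" "Qs \<noteq> []"
    and "integrable \<rho> f" "A \<in> sets borel"
  shows "(LINT x:A|\<rho>. f x) = (\<Sum>Q\<leftarrow>Qs. LINT x:A \<inter> Q|\<rho>. f x)"
proof -
  obtain y \<phi> where "inj_on y {..<length Qs}"
    "\<And>j. j < length Qs \<Longrightarrow> Qs ! j = laguerre_cell {..<length Qs} y \<phi> j"
    using assms(1) unfolding laguerre_tessellation_def by auto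
  then show ?thesis
    using set_integral_split_cells[of "{..<length Qs}" y f A \<phi>] assms(2-4)
    by (simp add: sum_list_sum_nth atLeast0LessThan lessThan_empty_iff)
qed

lemma integral_hierarchical_cells:
  fixes f :: "'a \<Rightarrow> 'b::{banach, second_countable_topology}"
  assumes "hierarchical_cells Ps" "integrable \<rho> f"
  shows "(LINT x|\<rho>. f x) = (\<Sum>P\<leftarrow>Ps. LINT x:P|\<rho>. f x)"
  using assms(1)
proof induction
  case (laguerre Qs)
  then show ?case
    using set_integral_laguerre_list[of Qs f UNIV] assms(2)
    by (simp add: set_lebesgue_integral_def)
next
  case (refine Ps i Qs)
  have "Ps ! i \<in> sets borel"
    by (rule hierarchical_cells_borel[OF refine.hyps(1) nth_mem[OF refine.hyps(2)]])
  then have "(LINT x:Ps ! i|\<rho>. f x) = (\<Sum>Q\<leftarrow>Qs. LINT x:Ps ! i \<inter> Q|\<rho>. f x)"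
    using refine.hyps assms(2) by (intro set_integral_laguerre_list)
  moreover have "(\<Sum>P\<leftarrow>Ps. LINT x:P|\<rho>. f x) = (\<Sum>P\<leftarrow>take i Ps. LINT x:P|\<rho>. f x)
      + ((LINT x:Ps ! i|\<rho>. f x) + (\<Sum>P\<leftarrow>drop (Suc i) Ps. LINT x:P|\<rho>. f x))"
    by (subst id_take_nth_drop[OF refine.hyps(2)]) simp
  ultimately show ?case
    using refine.IH by (simp add: comp_def)
qed

section \<open>Affine integrals and the convex order restricted to a cell\<close>

lemma set_integral_inner:
  assumes "A \<in> sets borel"
  shows "(LINT x:A|\<rho>. x \<bullet> a) = (LINT x:A|\<rho>. x) \<bullet> a"
proof -
  have "(LINT x|\<rho>. (indicator A x *\<^sub>R x) \<bullet> a) = (LINT x|\<rho>. indicator A x *\<^sub>R x) \<bullet> a"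
    using set_integrable_borel[OF integrable_ident assms]
    by (intro integral_inner_left) (simp add: set_integrable_def)
  then show ?thesis by (simp add: set_lebesgue_integral_def)
qed

lemma set_integral_affine:
  assumes "A \<in> sets borel"
  shows "(LINT x:A|\<rho>. x \<bullet> a - c) = (LINT x:A|\<rho>. x) \<bullet> a - c * measure \<rho> A"
proof -
  have "(LINT x:A|\<rho>. x \<bullet> a - c) = (LINT x:A|\<rho>. x \<bullet> a) - (LINT x:A|\<rho>. c)"
    using assms by (intro set_integral_diff set_integrable_borel) auto
  then show ?thesis
    using assms by (simp add: set_integral_inner) (simp add: set_lebesgue_integral_def)
qed

text \<open>Convex order between the unnormalised measures \<Sum> v_i \<delta>_(b_i), i in
  \<open>J\<close>, and \<rho> restricted to \<open>A\<close>. Integrable tests keep the Bochner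
  integral meaningful; they include all maxima of finitely many affine functions.\<close>

definition dominated :: "('n \<Rightarrow> real) \<Rightarrow> 'a set \<Rightarrow> 'n set \<Rightarrow> ('n \<Rightarrow> 'a) \<Rightarrow> bool" where
  "dominated v A J b \<longleftrightarrow> (\<forall>\<psi>. convex_on UNIV \<psi> \<longrightarrow> integrable \<rho> \<psi> \<longrightarrow>
     (\<Sum>i\<in>J. v i * \<psi> (b i)) \<le> (LINT x:A|\<rho>. \<psi> x))"

text \<open>Equal mass and first moment, that is, equal integrals of all affine functions. This is
  what volumes and barycenters provide on each cell.\<close>

definition matched :: "('n \<Rightarrow> real) \<Rightarrow> ('n \<Rightarrow> 'a) \<Rightarrow> 'a set \<Rightarrow> 'n set \<Rightarrow> bool" where
  "matched v b A J \<longleftrightarrow>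
     (\<Sum>i\<in>J. v i) = measure \<rho> A \<and> (\<Sum>i\<in>J. v i *\<^sub>R b i) = (LINT x:A|\<rho>. x)"

text \<open>A linear function and its negative are both convex, so dominance forces equality of
  first moments. For a single label with nonzero weight this determines the point
  \<open>b i\<close>.\<close>

lemma dominated_barycenter:
  assumes "dominated v A J b" "A \<in> sets borel"
  shows "(\<Sum>i\<in>J. v i *\<^sub>R b i) = (LINT x:A|\<rho>. x)"
proof -
  have le: "(\<Sum>i\<in>J. v i *\<^sub>R b i) \<bullet> a \<le> (LINT x:A|\<rho>. x) \<bullet> a" for a
  proof -
    have "convex_on UNIV (\<lambda>x::'a. x \<bullet> a)" using convex_on_inner_right[of a 0] by simp
    then have "(\<Sum>i\<in>J. v i * (b i \<bullet> a)) \<le> (LINT x:A|\<rho>. x \<bullet> a)"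
      using assms(1) integrable_inner unfolding dominated_def by blast
    then show ?thesis
      by (simp add: inner_sum_left set_integral_inner[OF assms(2)])
  qed
  have "(\<Sum>i\<in>J. v i *\<^sub>R b i) \<bullet> a = (LINT x:A|\<rho>. x) \<bullet> a" for a
    using le[of a] le[of "- a"] by simp
  then show ?thesis using vector_eq_rdot by blast
qed

text \<open>The affine functional \<open>S\<close> is bounded on dominated families by the integral
  of the maximum, and \<open>b\<close> attains the bound because it is matched on each cell. As
  \<open>b\<close> lies strictly between \<open>b'\<close> and \<open>b''\<close>, the endpoint
  \<open>b'\<close> attains it too. The perturbed inequality at \<open>b'\<close> is thus an
  equality for perturbation size 0, and its right derivative there is dominance on the single
  cell.\<close>

lemma dominated_laguerre_split:
  fixes v :: "'n \<Rightarrow> real"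
  assumes K: "finite K" "K \<noteq> {}" "inj_on y K" and A: "A \<in> sets borel"
    and J: "\<And>k. k \<in> K \<Longrightarrow> finite (J k)" "disjoint_family_on J K"
    and v: "\<And>i. 0 \<le> v i"
    and dom: "dominated v A (\<Union>k\<in>K. J k) b'" "dominated v A (\<Union>k\<in>K. J k) b''"
    and t: "0 < t" "t < 1" and b: "\<And>i. b i = (1 - t) *\<^sub>R b' i + t *\<^sub>R b'' i"
    and m: "\<And>k. k \<in> K \<Longrightarrow> matched v b (A \<inter> laguerre_cell K y \<phi> k) (J k)"
    and k: "k \<in> K"
  shows "dominated v (A \<inter> laguerre_cell K y \<phi> k) (J k) b'"
proof -
  define M where "M \<psi> x = Max ((\<lambda>k. x \<bullet> y k - \<phi> k + \<psi> k x) ` K)" for \<psi> x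
  define S where "S c = (\<Sum>k\<in>K. \<Sum>i\<in>J k. v i * (c i \<bullet> y k - \<phi> k))" for c
  \<comment> \<open>At a point of group \<open>k\<close> the maximum is at least its
    \<open>k\<close>-th entry, and the maximum is an admissible convex test function.\<close>
  have bound: "S c + (\<Sum>k\<in>K. \<Sum>i\<in>J k. v i * \<psi> k (c i)) \<le> (LINT x:A|\<rho>. M \<psi> x)"
    if c: "dominated v A (\<Union>k\<in>K. J k) c"
      and \<psi>: "\<And>k. convex_on UNIV (\<psi> k)" "\<And>k. integrable \<rho> (\<psi> k)" for c \<psi>
  proof -
    have "S c + (\<Sum>k\<in>K. \<Sum>i\<in>J k. v i * \<psi> k (c i))
        = (\<Sum>k\<in>K. \<Sum>i\<in>J k. v i * (c i \<bullet> y k - \<phi> k + \<psi> k (c i)))"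
      unfolding S_def by (simp add: sum.distrib distrib_left)
    also have "\<dots> \<le> (\<Sum>k\<in>K. \<Sum>i\<in>J k. v i * M \<psi> (c i))"
      unfolding M_def using K(1) v by (intro sum_mono mult_left_mono Max_ge) auto
    also have "\<dots> = (\<Sum>i\<in>(\<Union>k\<in>K. J k). v i * M \<psi> (c i))"
      using K(1) J by (intro sum.UNION_disjoint[symmetric]) (auto simp: disjoint_family_on_def)
    also have "\<dots> \<le> (LINT x:A|\<rho>. M \<psi> x)"
    proof -
      have "convex_on UNIV (M \<psi>)"
        unfolding M_def using K(1,2) \<psi>(1) convex_on_inner_right
        by (intro convex_on_Max convex_on_add) auto
      moreover have "integrable \<rho> (M \<psi>)"
        unfolding M_def using K(1,2) \<psi>(2) by (intro integrable_Max) auto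
      ultimately show ?thesis using c unfolding dominated_def by blast
    qed
    finally show ?thesis .
  qed
  have S_b: "S b = (LINT x:A|\<rho>. M (\<lambda>_ _. 0) x)"
  proof -
    have "(LINT x:A|\<rho>. M (\<lambda>_ _. 0) x)
        = (\<Sum>k\<in>K. LINT x:A \<inter> laguerre_cell K y \<phi> k|\<rho>. M (\<lambda>_ _. 0) x)"
      unfolding M_def using K A by (intro set_integral_split_cells integrable_Max) auto
    also have "\<dots> = (\<Sum>k\<in>K. LINT x:A \<inter> laguerre_cell K y \<phi> k|\<rho>. x \<bullet> y k - \<phi> k)"
      using K(1) A unfolding M_def
      by (intro sum.cong set_lebesgue_integral_cong) (auto simp: Max_on_laguerre_cell)
    also have "\<dots> = S b"
      unfolding S_def
    proof (intro sum.cong refl)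
      fix k assume "k \<in> K"
      then have "(LINT x:A \<inter> laguerre_cell K y \<phi> k|\<rho>. x \<bullet> y k - \<phi> k)
          = (\<Sum>i\<in>J k. v i *\<^sub>R b i) \<bullet> y k - \<phi> k * (\<Sum>i\<in>J k. v i)"
        using m A by (subst set_integral_affine) (auto simp: matched_def)
      also have "\<dots> = (\<Sum>i\<in>J k. v i * (b i \<bullet> y k - \<phi> k))"
        by (simp add: inner_sum_left sum_distrib_left sum_subtractf right_diff_distrib mult.commute)
      finally show "(LINT x:A \<inter> laguerre_cell K y \<phi> k|\<rho>. x \<bullet> y k - \<phi> k)
          = (\<Sum>i\<in>J k. v i * (b i \<bullet> y k - \<phi> k))" .
    qed
    finally show ?thesis by simp
  qed
  have "S b = (1 - t) * S b' + t * S b''"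
    unfolding S_def sum_distrib_left sum.distrib[symmetric] b
    by (intro sum.cong refl) (simp add: inner_add_left algebra_simps)
  moreover have S_le: "S c \<le> S b" if "dominated v A (\<Union>k\<in>K. J k) c" for c
    using bound[OF that, of "\<lambda>_ _. 0"] S_b by (simp add: convex_on_const)
  from S_le[OF dom(1)] have "S b' \<le> S b" .
  moreover from S_le[OF dom(2)] have "t * S b'' \<le> t * S b"
    using t by simp
  ultimately have "(1 - t) * S b \<le> (1 - t) * S b'"
    by (simp add: algebra_simps)
  then have S_b': "S b' = S b"
    using \<open>S b' \<le> S b\<close> t by simp
  show ?thesis
    unfolding dominated_def
  proof (intro allI impI)
    fix \<psi> :: "'a \<Rightarrow> real" assume \<psi>: "convex_on UNIV \<psi>" "integrable \<rho> \<psi>"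
    \<comment> \<open>Perturbing only slot \<open>k\<close> makes the derivative see cell
      \<open>k\<close> and group \<open>J k\<close> alone.\<close>
    define \<Psi> where "\<Psi> j x = (if j = k then \<psi> x else 0)" for j x
    have \<Psi>: "convex_on UNIV (\<Psi> j)" "integrable \<rho> (\<Psi> j)" for j
      using \<psi> unfolding \<Psi>_def by (cases "j = k"; simp add: convex_on_const)+
    have sum_\<Psi>: "(\<Sum>j\<in>K. \<Sum>i\<in>J j. v i * \<Psi> j (b' i)) = (\<Sum>i\<in>J k. v i * \<psi> (b' i))"
    proof -
      have "(\<Sum>j\<in>K. \<Sum>i\<in>J j. v i * \<Psi> j (b' i))
          = (\<Sum>j\<in>K. if j = k then \<Sum>i\<in>J k. v i * \<psi> (b' i) else 0)"
        unfolding \<Psi>_def by (intro sum.cong) auto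
      then show ?thesis using K(1) k by simp
    qed
    have "(\<Sum>i\<in>J k. v i * \<psi> (b' i))
        \<le> (\<Sum>j\<in>K. LINT x:A \<inter> laguerre_cell K y \<phi> j|\<rho>. \<Psi> j x)"
    proof (rule le_derivative_of_Max[OF K A \<Psi>(2)])
      fix s :: real assume "0 < s"
      then have "S b' + (\<Sum>j\<in>K. \<Sum>i\<in>J j. v i * (s * \<Psi> j (b' i)))
          \<le> (LINT x:A|\<rho>. M (\<lambda>j x. s * \<Psi> j x) x)"
        using \<Psi> by (intro bound dom(1)) auto
      moreover have "(\<Sum>j\<in>K. \<Sum>i\<in>J j. v i * (s * \<Psi> j (b' i)))
          = s * (\<Sum>i\<in>J k. v i * \<psi> (b' i))"
        unfolding sum_\<Psi>[symmetric] sum_distrib_left by (simp add: mult.left_commute)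
      ultimately show "(LINT x:A|\<rho>. Max ((\<lambda>j. x \<bullet> y j - \<phi> j) ` K))
          + s * (\<Sum>i\<in>J k. v i * \<psi> (b' i))
          \<le> (LINT x:A|\<rho>. Max ((\<lambda>j. x \<bullet> y j - \<phi> j + s * \<Psi> j x) ` K))"
        using S_b S_b' unfolding M_def by simp
    qed
    also have "\<dots> = (\<Sum>j\<in>K. if j = k then LINT x:A \<inter> laguerre_cell K y \<phi> k|\<rho>. \<psi> x else 0)"
      unfolding \<Psi>_def by (intro sum.cong) (auto simp: set_lebesgue_integral_def)
    also have "\<dots> = (LINT x:A \<inter> laguerre_cell K y \<phi> k|\<rho>. \<psi> x)"
      using K(1) k by simp
    finally show "(\<Sum>i\<in>J k. v i * \<psi> (b' i)) \<le> (LINT x:A \<inter> laguerre_cell K y \<phi> k|\<rho>. \<psi> x)" .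
  qed
qed

lemma dominated_laguerre_list:
  fixes v :: "'n::finite \<Rightarrow> real"
  assumes Qs: "laguerre_tessellation {..<length Qs} (\<lambda>j. Qs ! j)" "Qs \<noteq> []"
    and A: "A \<in> sets borel" and v: "\<And>i. 0 \<le> v i"
    and t: "0 < t" "t < 1" and b: "\<And>i. b i = (1 - t) *\<^sub>R b' i + t *\<^sub>R b'' i"
    and m: "list_all2 (\<lambda>Q. matched v b (A \<inter> Q)) Qs Js"
    and disj: "sorted_wrt (\<lambda>A B. A \<inter> B = {}) Js"
    and dom: "dominated v A (\<Union>(set Js)) b'" "dominated v A (\<Union>(set Js)) b''"
  shows "list_all2 (\<lambda>Q J. dominated v (A \<inter> Q) J b') Qs Js"
proof -
  obtain y \<phi> where y: "inj_on y {..<length Qs}"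
    and Q: "\<And>j. j < length Qs \<Longrightarrow> Qs ! j = laguerre_cell {..<length Qs} y \<phi> j"
    using Qs(1) unfolding laguerre_tessellation_def by auto
  have len: "length Js = length Qs" using m by (simp add: list_all2_lengthD)
  have Un: "(\<Union>k\<in>{..<length Qs}. Js ! k) = \<Union>(set Js)"
    by (auto simp: set_conv_nth simp flip: len)
  have disj': "disjoint_family_on (\<lambda>k. Js ! k) {..<length Qs}"
    unfolding disjoint_family_on_def
  proof safe
    fix k l x assume "k < length Qs" "l < length Qs" "k \<noteq> l" "x \<in> Js ! k" "x \<in> Js ! l"
    then show "x \<in> {}"
      using sorted_wrt_nth_less[OF disj, of k l] sorted_wrt_nth_less[OF disj, of l k] len
      by (cases "k < l") auto
  qed
  show ?thesis
    unfolding list_all2_conv_all_nth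
  proof (intro conjI allI impI)
    fix k assume k: "k < length Qs"
    have "dominated v (A \<inter> laguerre_cell {..<length Qs} y \<phi> k) (Js ! k) b'"
    proof (rule dominated_laguerre_split[where J = "\<lambda>k. Js ! k" and K = "{..<length Qs}"])
      fix k assume "k \<in> {..<length Qs}"
      then show "matched v b (A \<inter> laguerre_cell {..<length Qs} y \<phi> k) (Js ! k)"
        using m Q by (auto simp: list_all2_conv_all_nth)
    qed (use Qs y A v t b dom disj' Un k in \<open>auto simp: lessThan_empty_iff\<close>)
    then show "dominated v (A \<inter> Qs ! k) (Js ! k) b'" using Q k by simp
  qed (use len in simp)
qed

text \<open>Induction along the refinements, with a set of labels attached to each cell. Starting
  from one label per cell, labels are merged when a refinement is undone, and dominance is then
  pushed back down to the finer cells.\<close>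

lemma dominated_hierarchical_cells:
  fixes v :: "'n::finite \<Rightarrow> real"
  assumes v: "\<And>i. 0 \<le> v i" and t: "0 < t" "t < 1"
    and b: "\<And>i. b i = (1 - t) *\<^sub>R b' i + t *\<^sub>R b'' i"
    and dom: "dominated v UNIV UNIV b'" "dominated v UNIV UNIV b''"
    and "hierarchical_cells Ps" "list_all2 (matched v b) Ps Js"
    and "sorted_wrt (\<lambda>A B. A \<inter> B = {}) Js" "\<Union>(set Js) = UNIV"
  shows "list_all2 (\<lambda>P J. dominated v P J b' \<and> dominated v P J b'') Ps Js"
proof -
  \<comment> \<open>Replacing \<open>t\<close> by \<open>1 - t\<close> exchanges the endpoints, so
    one split lemma serves both.\<close>
  have b_swap: "b i = (1 - (1 - t)) *\<^sub>R b'' i + (1 - t) *\<^sub>R b' i" for i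
    using b by simp
  have lag: "list_all2 (\<lambda>Q J. dominated v (A \<inter> Q) J b' \<and> dominated v (A \<inter> Q) J b'') Qs Js"
    if "laguerre_tessellation {..<length Qs} (\<lambda>j. Qs ! j)" "Qs \<noteq> []" "A \<in> sets borel"
      "list_all2 (\<lambda>Q. matched v b (A \<inter> Q)) Qs Js" "sorted_wrt (\<lambda>A B. A \<inter> B = {}) Js"
      "dominated v A (\<Union>(set Js)) b'" "dominated v A (\<Union>(set Js)) b''" for A Qs Js
    using dominated_laguerre_list[OF that(1-3) v t b that(4-7)]
      dominated_laguerre_list[OF that(1-3) v _ _ b_swap that(4,5,7,6)] t
    by (simp add: list_all2_conv_all_nth)
  show ?thesis
    using assms(7-10)
  proof (induction arbitrary: Js)
    case (laguerre Qs)
    then show ?case using lag[of Qs UNIV Js] dom by simp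
  next
    case (refine Ps i Qs)
    define P where "P = Ps ! i"
    have P: "P \<in> sets borel"
      unfolding P_def by (rule hierarchical_cells_borel[OF refine.hyps(1) nth_mem[OF refine.hyps(2)]])
    have Ps: "Ps = take i Ps @ P # drop (Suc i) Ps"
      unfolding P_def by (rule id_take_nth_drop[OF refine.hyps(2)])
    obtain Js1 Js2 Js3 where Js: "Js = Js1 @ Js2 @ Js3"
      and m: "list_all2 (matched v b) (take i Ps) Js1"
      "list_all2 (\<lambda>Q. matched v b (P \<inter> Q)) Qs Js2"
      "list_all2 (matched v b) (drop (Suc i) Ps) Js3"
      using refine.prems(1)
      by (auto simp: list_all2_append1 list_all2_map1 P_def)
    have disj: "sorted_wrt (\<lambda>A B. A \<inter> B = {}) Js2"
      using refine.prems(2) unfolding Js by (simp add: sorted_wrt_append)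
    have len: "length Js2 = length Qs" using m(2) by (simp add: list_all2_lengthD)
    have sums: "(\<Sum>i\<in>\<Union>(set Js2). f i) = (\<Sum>k<length Qs. \<Sum>i\<in>Js2 ! k. f i)"
      for f :: "'n \<Rightarrow> 'z::comm_monoid_add"
      using sum_Union_disjoint_list[OF disj] len by simp
    have ints: "(LINT x:P|\<rho>. f x) = (\<Sum>k<length Qs. LINT x:P \<inter> Qs ! k|\<rho>. f x)"
      if "integrable \<rho> f" for f :: "'a \<Rightarrow> 'z::{banach, second_countable_topology}"
      using set_integral_laguerre_list[OF refine.hyps(4,3) that P]
      by (simp add: sum_list_sum_nth atLeast0LessThan)
    have meas: "measure \<rho> P = (\<Sum>k<length Qs. measure \<rho> (P \<inter> Qs ! k))"
    proof -
      have "P \<inter> Qs ! k \<in> sets borel" if "k < length Qs" for k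
        using hierarchical_cells_borel[OF hierarchical_cells.laguerre[OF refine.hyps(3,4)]] P that
        by auto
      then show ?thesis
        using ints[of "\<lambda>_. 1 :: real"] P by (simp add: set_lebesgue_integral_def)
    qed
    \<comment> \<open>Masses and first moments of the pieces add up, so giving \<open>P\<close> all
      labels of its pieces yields a matched coarser list, to which the induction hypothesis
      applies.\<close>
    have "matched v b P (\<Union>(set Js2))"
      unfolding matched_def sums meas ints[OF integrable_ident]
      using m(2) by (auto simp: list_all2_conv_all_nth matched_def intro!: sum.cong)
    then have "list_all2 (matched v b) Ps (Js1 @ \<Union>(set Js2) # Js3)"
      using m(1,3) by (subst Ps) (auto intro!: list_all2_appendI)
    moreover have "sorted_wrt (\<lambda>A B. A \<inter> B = {}) (Js1 @ \<Union>(set Js2) # Js3)"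
      using refine.prems(2) unfolding Js by (simp add: sorted_wrt_append) blast
    moreover have "\<Union>(set (Js1 @ \<Union>(set Js2) # Js3)) = UNIV"
      using refine.prems(3) unfolding Js by auto
    ultimately have "list_all2 (\<lambda>P J. dominated v P J b' \<and> dominated v P J b'') Ps
        (Js1 @ \<Union>(set Js2) # Js3)"
      by (rule refine.IH)
    moreover have "length (take i Ps) = length Js1"
      using m(1) by (rule list_all2_lengthD)
    ultimately have IH: "list_all2 (\<lambda>P J. dominated v P J b' \<and> dominated v P J b'') (take i Ps) Js1"
      "dominated v P (\<Union>(set Js2)) b'" "dominated v P (\<Union>(set Js2)) b''"
      "list_all2 (\<lambda>P J. dominated v P J b' \<and> dominated v P J b'') (drop (Suc i) Ps) Js3"
      by (subst (asm) Ps, simp add: list_all2_append)+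
    show ?case
      unfolding Js using lag[OF refine.hyps(4,3) P m(2) disj IH(2,3)] IH(1,4)
      by (auto simp: list_all2_map1 P_def intro!: list_all2_appendI)
  qed
qed

section \<open>Laguerre tessellations with prescribed volumes\<close>

text \<open>\<open>g\<close> is the dual functional of semi-discrete optimal transport; its partial
  derivative in the i-th weight is v_i minus the volume of the i-th cell, so a minimiser has the
  prescribed volumes. A minimum exists because \<open>g\<close> is invariant under adding constants
  to the weights and grows once the smallest weight is normalised to 0.\<close>

lemma laguerre_volumes_exist:
  fixes y :: "'n::finite \<Rightarrow> 'a" and v :: "'n \<Rightarrow> real"
  assumes y: "inj y" and v: "\<And>i. v i > 0" "(\<Sum>i\<in>UNIV. v i) = 1"
  shows "\<exists>\<phi>. \<forall>i. measure \<rho> (laguerre_cell UNIV y \<phi> i) = v i"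
proof -
  define m where "m \<phi> x = Max (range (\<lambda>i. x \<bullet> y i - \<phi> $ i))" for \<phi> :: "real ^ 'n" and x
  define g where "g \<phi> = (LINT x|\<rho>. m \<phi> x) + (\<Sum>i\<in>UNIV. v i * \<phi> $ i)" for \<phi>
  have m_int: "integrable \<rho> (m \<phi>)" for \<phi>
    unfolding m_def by (intro integrable_Max) auto
  have cont: "continuous_on UNIV g"
  proof -
    have "((\<lambda>\<phi>. LINT x|\<rho>. m \<phi> x) \<longlongrightarrow> (LINT x|\<rho>. m \<phi>0 x)) (at \<phi>0)" for \<phi>0
    proof (rule LIM_zero_cancel, rule Lim_null_comparison)
      show "((\<lambda>\<phi>. \<Sum>i\<in>UNIV. \<bar>\<phi> $ i - \<phi>0 $ i\<bar>) \<longlongrightarrow> 0) (at \<phi>0)"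
        by (auto intro!: tendsto_eq_intros)
      have "\<bar>(LINT x|\<rho>. m \<phi> x) - (LINT x|\<rho>. m \<phi>0 x)\<bar> \<le> (\<Sum>i\<in>UNIV. \<bar>\<phi> $ i - \<phi>0 $ i\<bar>)" for \<phi>
      proof -
        have "\<bar>(LINT x|\<rho>. m \<phi> x) - (LINT x|\<rho>. m \<phi>0 x)\<bar> = \<bar>LINT x|\<rho>. m \<phi> x - m \<phi>0 x\<bar>"
          using m_int by simp
        also have "\<dots> \<le> (LINT x|\<rho>. \<bar>m \<phi> x - m \<phi>0 x\<bar>)"
          by (rule integral_abs_bound)
        also have "\<dots> \<le> (LINT x|\<rho>. (\<Sum>i\<in>UNIV. \<bar>\<phi> $ i - \<phi>0 $ i\<bar>))"
        proof (rule integral_mono)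
          fix x
          show "\<bar>m \<phi> x - m \<phi>0 x\<bar> \<le> (\<Sum>i\<in>UNIV. \<bar>\<phi> $ i - \<phi>0 $ i\<bar>)"
            unfolding m_def using abs_Max_diff_le[of "UNIV :: 'n set"
              "\<lambda>i. x \<bullet> y i - \<phi> $ i" "\<lambda>i. x \<bullet> y i - \<phi>0 $ i"]
            by (simp add: abs_minus_commute)
        qed (use m_int in auto)
        finally show ?thesis by (simp add: prob_space)
      qed
      then show "\<forall>\<^sub>F \<phi> in at \<phi>0. norm ((LINT x|\<rho>. m \<phi> x) - (LINT x|\<rho>. m \<phi>0 x))
          \<le> (\<Sum>i\<in>UNIV. \<bar>\<phi> $ i - \<phi>0 $ i\<bar>)" by simp
    qed
    then have "continuous_on UNIV (\<lambda>\<phi>. LINT x|\<rho>. m \<phi> x)"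
      by (simp add: continuous_on_def)
    then show ?thesis unfolding g_def by (intro continuous_intros)
  qed
  define C where "C = (\<Sum>i\<in>UNIV. \<bar>LINT x|\<rho>. x \<bullet> y i\<bar>)"
  \<comment> \<open>The sum exceeds each of its terms: if the weights are nonnegative and some
    weight \<open>j\<close> is larger than \<open>R\<close>, then \<open>v j\<close> times it is at
    least \<open>C + \<bar>g 0\<bar>\<close>, which outweighs the lower bound \<open>- C\<close> of
    the integral.\<close>
  define R where "R = (\<Sum>j\<in>UNIV. (C + \<bar>g 0\<bar>) / v j)"
  have C0: "C \<ge> 0" unfolding C_def by (simp add: sum_nonneg)
  have R: "(C + \<bar>g 0\<bar>) / v j \<le> R" for j
    unfolding R_def using C0 v(1) by (intro member_le_sum) (auto simp: less_imp_le)
  have R0: "R \<ge> 0"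
    unfolding R_def using C0 v(1) by (intro sum_nonneg) (auto simp: less_imp_le)
  define S where "S = cbox (0 :: real ^ 'n) (\<chi> i. R)"
  have S: "\<phi> \<in> S \<longleftrightarrow> (\<forall>i. 0 \<le> \<phi> $ i \<and> \<phi> $ i \<le> R)" for \<phi>
    unfolding S_def by (simp add: mem_box_cart)
  have "0 \<in> S" using S R0 by simp
  moreover have "compact S" unfolding S_def by simp
  ultimately obtain \<phi> where \<phi>: "\<phi> \<in> S" "\<And>\<theta>. \<theta> \<in> S \<Longrightarrow> g \<phi> \<le> g \<theta>"
    using continuous_attains_inf[of S g] continuous_on_subset[OF cont] by blast
  have min: "g \<phi> \<le> g \<theta>" for \<theta>
  proof -
    \<comment> \<open>Shifting by the smallest weight leaves \<open>g\<close> unchanged, since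
      \<rho> and \<open>v\<close> both have total mass 1, and reduces the comparison to nonnegative
      weights with one equal to 0.\<close>
    obtain k where k: "\<And>i. \<theta> $ k \<le> \<theta> $ i"
      using Min_in[of "range (\<lambda>i. \<theta> $ i)"] Min_le[of "range (\<lambda>i. \<theta> $ i)"] by fastforce
    define \<theta>' where "\<theta>' = (\<chi> i. \<theta> $ i - \<theta> $ k)"
    have "g \<theta>' = g \<theta>"
    proof -
      have "m \<theta>' x = m \<theta> x + \<theta> $ k" for x
        unfolding m_def \<theta>'_def
        using Max_add_commute[of UNIV "\<lambda>i. x \<bullet> y i - \<theta> $ i" "\<theta> $ k"] by (simp add: algebra_simps)
      then have "(LINT x|\<rho>. m \<theta>' x) = (LINT x|\<rho>. m \<theta> x) + \<theta> $ k"
        using m_int by (simp add: prob_space)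
      moreover have "(\<Sum>i\<in>UNIV. v i * \<theta>' $ i) = (\<Sum>i\<in>UNIV. v i * \<theta> $ i) - \<theta> $ k"
        unfolding \<theta>'_def using v(2)
        by (simp add: right_diff_distrib sum_subtractf flip: sum_distrib_right)
      ultimately show ?thesis unfolding g_def by simp
    qed
    moreover have "g \<phi> \<le> g \<theta>'"
    proof (cases "\<theta>' \<in> S")
      case False
      have nonneg: "\<theta>' $ i \<ge> 0" for i unfolding \<theta>'_def using k by simp
      then obtain j where j: "\<theta>' $ j > R"
        using False S by (auto simp: not_le)
      have "- C \<le> (LINT x|\<rho>. x \<bullet> y k)"
        unfolding C_def using member_le_sum[of k UNIV "\<lambda>i. \<bar>LINT x|\<rho>. x \<bullet> y i\<bar>"] by simp
      also have "\<dots> \<le> (LINT x|\<rho>. m \<theta>' x)"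
      proof (rule integral_mono)
        fix x
        have "x \<bullet> y k - \<theta>' $ k \<le> m \<theta>' x" unfolding m_def by (intro Max_ge) auto
        then show "x \<bullet> y k \<le> m \<theta>' x" unfolding \<theta>'_def by simp
      qed (use m_int in auto)
      finally have "- C + v j * \<theta>' $ j \<le> g \<theta>'"
        unfolding g_def using member_le_sum[of j UNIV "\<lambda>i. v i * \<theta>' $ i"] nonneg v(1)
        by (simp add: less_imp_le add_mono)
      moreover have "C + \<bar>g 0\<bar> \<le> v j * \<theta>' $ j"
      proof -
        have "(C + \<bar>g 0\<bar>) / v j \<le> \<theta>' $ j" using R[of j] j by simp
        then show ?thesis using v(1)[of j] by (simp add: divide_le_eq mult.commute)
      qed
      ultimately have "g 0 \<le> g \<theta>'" by simp
      then show ?thesis using \<phi>(2)[OF \<open>0 \<in> S\<close>] by simp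
    qed (use \<phi>(2) in simp)
    ultimately show ?thesis by simp
  qed
  \<comment> \<open>First-order condition at the minimiser in direction \<open>- z\<close>, obtained
    with constant perturbations \<open>z i\<close> of the affine functions.\<close>
  have le: "(\<Sum>i\<in>UNIV. v i * z i) \<le> (\<Sum>i\<in>UNIV. measure \<rho> (laguerre_cell UNIV y (($) \<phi>) i) * z i)" for z
  proof -
    have "(\<Sum>i\<in>UNIV. v i * z i) \<le> (\<Sum>i\<in>UNIV. LINT x:UNIV \<inter> laguerre_cell UNIV y (($) \<phi>) i|\<rho>. z i)"
    proof (rule le_derivative_of_Max)
      fix t :: real
      have m\<phi>: "m \<phi> = (\<lambda>x. Max (range (\<lambda>i. x \<bullet> y i - \<phi> $ i)))"
        "m (\<chi> i. \<phi> $ i - t * z i) = (\<lambda>x. Max (range (\<lambda>i. x \<bullet> y i - \<phi> $ i + t * z i)))"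
        unfolding m_def by (simp_all add: algebra_simps)
      have "(\<Sum>i\<in>UNIV. v i * (\<phi> $ i - t * z i))
          = (\<Sum>i\<in>UNIV. v i * \<phi> $ i) - t * (\<Sum>i\<in>UNIV. v i * z i)"
        by (simp add: right_diff_distrib sum_subtractf sum_distrib_left mult.left_commute)
      then show "(LINT x:UNIV|\<rho>. Max (range (\<lambda>i. x \<bullet> y i - \<phi> $ i)))
          + t * (\<Sum>i\<in>UNIV. v i * z i)
          \<le> (LINT x:UNIV|\<rho>. Max (range (\<lambda>i. x \<bullet> y i - \<phi> $ i + t * z i)))"
        using min[of "\<chi> i. \<phi> $ i - t * z i"] unfolding g_def m\<phi>
        by (simp add: set_lebesgue_integral_def)
    qed (use y in auto)
    then show ?thesis by (simp add: set_lebesgue_integral_def)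
  qed
  have "measure \<rho> (laguerre_cell UNIV y (($) \<phi>) i) = v i" for i
  proof -
    \<comment> \<open>Both signs of a unit vector turn the linear inequality into an
      equality.\<close>
    have *: "(\<Sum>j\<in>UNIV. a j * (if j = i then c else 0)) = a i * c" for a :: "'n \<Rightarrow> real" and c
      by (simp add: if_distrib cong: if_cong)
    show ?thesis
      using le[of "\<lambda>j. if j = i then 1 else 0"] le[of "\<lambda>j. if j = i then - 1 else 0"]
      unfolding * by simp
  qed
  then show ?thesis by blast
qed

end

section \<open>Composition of hierarchical Laguerre tessellations\<close>

lemma hierarchical_cells_append_laguerre:
  assumes "hierarchical_cells (xs @ P # ys)" "Qs \<noteq> []"
    "laguerre_tessellation {..<length Qs} (\<lambda>j. Qs ! j)"
  shows "hierarchical_cells (xs @ map (\<lambda>Q. P \<inter> Q) Qs @ ys)"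
  using hierarchical_cells.refine[OF assms(1) _ assms(2,3), of "length xs"] by simp

text \<open>The definition refines by Laguerre tessellations only. Each refinement step of
  \<open>Rs\<close> is also one of the composite list, because
  \<open>P \<inter> (R \<inter> Q) = (P \<inter> R) \<inter> Q\<close>.\<close>

lemma hierarchical_cells_append:
  assumes "hierarchical_cells Rs" "hierarchical_cells (xs @ P # ys)"
  shows "hierarchical_cells (xs @ map (\<lambda>R. P \<inter> R) Rs @ ys)"
  using assms
proof (induction Rs)
  case (laguerre Qs)
  then show ?case by (intro hierarchical_cells_append_laguerre)
next
  case (refine Ps i Qs)
  have "map (\<lambda>R. P \<inter> R) Ps = map (\<lambda>R. P \<inter> R) (take i Ps) @
      (P \<inter> Ps ! i) # map (\<lambda>R. P \<inter> R) (drop (Suc i) Ps)"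
    by (subst id_take_nth_drop[OF refine.hyps(2)]) simp
  then have "hierarchical_cells ((xs @ map (\<lambda>R. P \<inter> R) (take i Ps)) @
      (P \<inter> Ps ! i) # (map (\<lambda>R. P \<inter> R) (drop (Suc i) Ps) @ ys))"
    using refine.IH[OF refine.prems] by simp
  from hierarchical_cells_append_laguerre[OF this refine.hyps(3,4)]
  show ?case by (simp add: comp_def Int_assoc)
qed

text \<open>The cells are subdivided from left to right; the prefix \<open>xs\<close> collects those
  already treated and must be general in the induction.\<close>

lemma hierarchical_cells_concat:
  assumes "hierarchical_cells (xs @ map Q ks)" "\<And>k. k \<in> set ks \<Longrightarrow> hierarchical_cells (Rs k)"
  shows "hierarchical_cells (xs @ concat (map (\<lambda>k. map (\<lambda>R. Q k \<inter> R) (Rs k)) ks))"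
  using assms
proof (induction ks arbitrary: xs)
  case (Cons k ks)
  have "hierarchical_cells ((xs @ map (\<lambda>R. Q k \<inter> R) (Rs k)) @ map Q ks)"
    using hierarchical_cells_append[of "Rs k" xs "Q k" "map Q ks"] Cons.prems by simp
  from Cons.IH[OF this] show ?case using Cons.prems(2) by simp
qed simp

lemma laguerre_tessellation_list:
  assumes "laguerre_tessellation (set ks) Q" "distinct ks"
  shows "laguerre_tessellation {..<length ks} (\<lambda>j. map Q ks ! j)"
proof -
  obtain y \<phi> where y: "inj_on y (set ks)"
    and Q: "\<And>k. k \<in> set ks \<Longrightarrow> Q k = laguerre_cell (set ks) y \<phi> k"
    using assms(1) unfolding laguerre_tessellation_def by auto
  have "inj_on (\<lambda>j. y (ks ! j)) {..<length ks}"
    using y assms(2) by (intro inj_onI) (auto dest: inj_onD simp: nth_eq_iff_index_eq)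
  moreover have "map Q ks ! j = laguerre_cell {..<length ks} (\<lambda>j. y (ks ! j)) (\<lambda>j. \<phi> (ks ! j)) j"
    if "j < length ks" for j
    using that Q[OF nth_mem[OF that]] assms(2)
    by (auto simp: laguerre_cell_def all_set_conv_all_nth nth_eq_iff_index_eq)
  ultimately show ?thesis
    unfolding laguerre_tessellation_def by (intro exI conjI) auto
qed

text \<open>Cells keep their labels while the order of the list stays hidden, so tessellations
  indexed by subsets of the labels can be assembled without tracking positions.\<close>

definition hierarchical_on :: "'i set \<Rightarrow> ('i \<Rightarrow> 'a::euclidean_space set) \<Rightarrow> bool" where
  "hierarchical_on I P \<longleftrightarrow> (\<exists>ks. distinct ks \<and> set ks = I \<and> hierarchical_cells (map P ks))"

lemma hierarchical_on_UNIV: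
  assumes "hierarchical_on UNIV (P :: 'n::finite \<Rightarrow> _)"
  shows "hierarchical_laguerre_tessellation P"
proof -
  obtain ks where ks: "distinct ks" "set ks = (UNIV :: 'n set)" "hierarchical_cells (map P ks)"
    using assms unfolding hierarchical_on_def by blast
  have "bij_betw (\<lambda>j. ks ! j) {..<length ks} UNIV"
    using ks by (intro bij_betw_nth) auto
  then have inv: "bij_betw (inv_into {..<length ks} (\<lambda>j. ks ! j)) UNIV {..<length ks}"
    by (rule bij_betw_inv_into)
  moreover have "P i = map P ks ! inv_into {..<length ks} (\<lambda>j. ks ! j) i" for i
  proof -
    have "ks ! inv_into {..<length ks} (\<lambda>j. ks ! j) i = i"
      "inv_into {..<length ks} (\<lambda>j. ks ! j) i \<in> {..<length ks}"
      using \<open>bij_betw (\<lambda>j. ks ! j) _ _\<close> bij_betwE[OF inv]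
      by (auto intro: f_inv_into_f simp: bij_betw_def)
    then show ?thesis by simp
  qed
  ultimately show ?thesis
    unfolding hierarchical_laguerre_tessellation_def using ks(3)
    by (intro exI[of _ "map P ks"] exI[of _ "inv_into {..<length ks} (\<lambda>j. ks ! j)"]) auto
qed

lemma laguerre_cell_singleton: "laguerre_cell {i} y \<phi> i = UNIV"
  by (simp add: laguerre_cell_def)

lemma hierarchical_on_singleton: "hierarchical_on {i} (\<lambda>_. UNIV :: 'a::euclidean_space set)"
proof -
  have "laguerre_tessellation (set [i]) (\<lambda>_. UNIV :: 'a set)"
    unfolding laguerre_tessellation_def by (auto simp: laguerre_cell_singleton)
  from laguerre_tessellation_list[OF this] show ?thesis
    unfolding hierarchical_on_def by (intro exI[of _ "[i]"]) (auto intro!: hierarchical_cells.laguerre)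
qed

text \<open>The shape of a degenerate limit: \<open>Z\<close> sends a label to its limit generator,
  \<open>Q\<close> has one cell per limit generator, and \<open>R k\<close> subdivides it among the
  labels collapsed to \<open>k\<close>.\<close>

lemma hierarchical_on_refine:
  assumes "finite I" "I \<noteq> {}" and Q: "laguerre_tessellation (Z ` I) Q"
    and R: "\<And>k. k \<in> Z ` I \<Longrightarrow> hierarchical_on {i \<in> I. Z i = k} (R k)"
  shows "hierarchical_on I (\<lambda>i. Q (Z i) \<inter> R (Z i) i)"
proof -
  obtain Ks where Ks: "set Ks = Z ` I" "distinct Ks"
    using finite_distinct_list[of "Z ` I"] assms(1) by auto
  have "\<forall>k\<in>Z ` I. \<exists>ks. distinct ks \<and> set ks = {i \<in> I. Z i = k} \<and> hierarchical_cells (map (R k) ks)"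
    using R unfolding hierarchical_on_def by blast
  from bchoice[OF this] obtain ks where "\<forall>k\<in>Z ` I. distinct (ks k) \<and>
      set (ks k) = {i \<in> I. Z i = k} \<and> hierarchical_cells (map (R k) (ks k))" ..
  then have ks: "\<And>k. k \<in> Z ` I \<Longrightarrow> distinct (ks k)"
    "\<And>k. k \<in> Z ` I \<Longrightarrow> set (ks k) = {i \<in> I. Z i = k}"
    "\<And>k. k \<in> Z ` I \<Longrightarrow> hierarchical_cells (map (R k) (ks k))"
    by blast+
  have "Ks \<noteq> []" using Ks assms(2) by auto
  then have hQ: "hierarchical_cells ([] @ map Q Ks)"
    using laguerre_tessellation_list[of Ks Q] Q Ks by (auto intro: hierarchical_cells.laguerre)
  have "hierarchical_cells (map (R k) (ks k))" if "k \<in> set Ks" for k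
    using ks(3) that unfolding Ks(1) .
  from hierarchical_cells_concat[OF hQ this]
  have "hierarchical_cells (concat (map (\<lambda>k. map (\<lambda>R. Q k \<inter> R) (map (R k) (ks k))) Ks))"
    by simp
  also have "map (\<lambda>k. map (\<lambda>R. Q k \<inter> R) (map (R k) (ks k))) Ks
      = map (\<lambda>k. map (\<lambda>i. Q (Z i) \<inter> R (Z i) i) (ks k)) Ks"
    using ks(2) Ks(1) by (intro map_cong) auto
  also have "concat \<dots> = map (\<lambda>i. Q (Z i) \<inter> R (Z i) i) (concat (map ks Ks))"
    by (simp add: map_concat comp_def)
  finally have "hierarchical_cells (map (\<lambda>i. Q (Z i) \<inter> R (Z i) i) (concat (map ks Ks)))" .
  moreover have "set (concat (map ks Ks)) = I"
    using Ks(1) ks(2) by auto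
  moreover have "distinct (concat (map ks Ks))"
  proof (rule distinct_concat)
    \<comment> \<open>Every group is nonempty and determines \<open>k\<close> as the common value of
      \<open>Z\<close>, so equal label lists belong to equal groups.\<close>
    have "inj_on ks (set Ks)"
    proof (rule inj_onI)
      fix k l assume kl: "k \<in> set Ks" "l \<in> set Ks" "ks k = ks l"
      then obtain i where i: "i \<in> I" "Z i = k" using Ks(1) by auto
      then have "i \<in> set (ks l)" using kl Ks(1) ks(2)[of k] by simp
      then show "k = l" using i kl Ks(1) ks(2)[of l] by simp
    qed
    then show "distinct (map ks Ks)" using Ks(2) by (simp add: distinct_map)
  qed (use Ks(1) ks(1,2) in auto)
  ultimately show ?thesis unfolding hierarchical_on_def by blast
qed

section \<open>Limits of Laguerre tessellations\<close>

text \<open>All affine functions are changed by the same summand and the same positive factor, which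
  preserves every comparison.\<close>

lemma laguerre_cell_normalize:
  assumes "0 < d"
    and "\<And>i. i \<in> I \<Longrightarrow> z i = (y i - a) /\<^sub>R d" "\<And>i. i \<in> I \<Longrightarrow> w i = (\<phi> i - e) / d" "i \<in> I"
  shows "laguerre_cell I z w i = laguerre_cell I y \<phi> i"
proof -
  have "x \<bullet> z j - w j \<le> x \<bullet> z i - w i \<longleftrightarrow> x \<bullet> y j - \<phi> j \<le> x \<bullet> y i - \<phi> i" if "j \<in> I" for x j
  proof -
    have *: "x \<bullet> z k - w k = (x \<bullet> y k - \<phi> k - (x \<bullet> a - e)) / d" if "k \<in> I" for k
      by (simp add: assms(2,3)[OF that] inner_diff_right divide_inverse algebra_simps)
    show ?thesis
      unfolding *[OF \<open>j \<in> I\<close>] *[OF \<open>i \<in> I\<close>] using assms(1) by (simp add: divide_le_cancel)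
  qed
  then show ?thesis unfolding laguerre_cell_def by auto
qed

text \<open>Successive extraction: later extractions do not destroy what was achieved, because
  \<open>P\<close> passes to subsequences.\<close>

lemma common_subsequence:
  assumes "finite K"
    and ex: "\<And>k s. k \<in> K \<Longrightarrow> strict_mono (s :: nat \<Rightarrow> nat) \<Longrightarrow> \<exists>r. strict_mono r \<and> P k (s \<circ> r)"
    and sub: "\<And>k s r. P k s \<Longrightarrow> strict_mono (r :: nat \<Rightarrow> nat) \<Longrightarrow> P k (s \<circ> r)"
  shows "\<exists>r. strict_mono r \<and> (\<forall>k\<in>K. P k r)"
  using assms(1) ex
proof (induction K)
  case empty
  then show ?case using strict_mono_id by blast
next
  case (insert k K)
  then obtain s where s: "strict_mono s" "\<forall>k\<in>K. P k s" by blast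
  obtain r where r: "strict_mono r" "P k (s \<circ> r)" using insert.prems[of k s] s by blast
  have "\<forall>k\<in>K. P k (s \<circ> r)" using s(2) sub r(1) by blast
  then show ?case
    using r(2) strict_mono_o[OF s(1) r(1)] by blast
qed

context hyperplane_null_measure
begin

lemma set_integral_tendsto:
  fixes f :: "'a \<Rightarrow> 'b::{banach, second_countable_topology}"
  assumes "integrable \<rho> f" "\<And>n. U n \<in> sets borel" "V \<in> sets borel"
    and ev: "AE x in \<rho>. \<forall>\<^sub>F n in sequentially. x \<in> U n \<longleftrightarrow> x \<in> V"
  shows "(\<lambda>n. LINT x:U n|\<rho>. f x) \<longlonglongrightarrow> (LINT x:V|\<rho>. f x)"
  unfolding set_lebesgue_integral_def
proof (rule integral_dominated_convergence[where w = "\<lambda>x. norm (f x)"])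
  show "AE x in \<rho>. (\<lambda>n. indicator (U n) x *\<^sub>R f x) \<longlonglongrightarrow> indicator V x *\<^sub>R f x"
    using ev
  proof eventually_elim
    case (elim x)
    then have "\<forall>\<^sub>F n in sequentially. indicator (U n) x *\<^sub>R f x = indicator V x *\<^sub>R f x"
      by eventually_elim (simp add: indicator_def)
    then show ?case by (rule tendsto_eventually)
  qed
  show "AE x in \<rho>. norm (indicator (U n) x *\<^sub>R f x) \<le> norm (f x)" for n
    by (intro AE_I2) (simp add: indicator_def)
  show "(\<lambda>x. indicator V x *\<^sub>R f x) \<in> borel_measurable \<rho>"
    using set_integrable_borel[OF assms(1,3)] by (auto simp: set_integrable_def)
  show "(\<lambda>x. indicator (U n) x *\<^sub>R f x) \<in> borel_measurable \<rho>" for n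
    using set_integrable_borel[OF assms(1,2)] by (auto simp: set_integrable_def)
  show "integrable \<rho> (\<lambda>x. norm (f x))" using assms(1) by auto
qed

lemma measure_tendsto:
  assumes "\<And>n. U n \<in> sets borel" "V \<in> sets borel"
    and "AE x in \<rho>. \<forall>\<^sub>F n in sequentially. x \<in> U n \<longleftrightarrow> x \<in> V"
  shows "(\<lambda>n. measure \<rho> (U n)) \<longlonglongrightarrow> measure \<rho> V"
  using set_integral_tendsto[OF integrable_const[of "1::real"] assms] assms(1,2)
  by (simp add: set_lebesgue_integral_def)

text \<open>By Markov's inequality the outside of a large ball has mass below \<open>c\<close>.
  Applied to cells of mass at least \<open>c\<close>, this supplies points of bounded norm, from
  which the weights are controlled.\<close>

lemma norm_tail_small:
  assumes "0 < c"
  obtains R where "0 < R" "\<And>B. B \<in> sets borel \<Longrightarrow> c \<le> measure \<rho> B \<Longrightarrow> \<exists>x\<in>B. norm x \<le> R"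
proof -
  \<comment> \<open>The summand 1 makes Markov's bound strictly smaller than \<open>c\<close>, also
    when the first moment is 0.\<close>
  define R where "R = (LINT x|\<rho>. norm x) / c + 1"
  have int: "integrable \<rho> (\<lambda>x. norm x)" by auto
  have E: "0 \<le> (LINT x|\<rho>. norm x)" by simp
  then have R: "0 < R" unfolding R_def using assms by (simp add: add_nonneg_pos)
  have "measure \<rho> {x \<in> space \<rho>. R \<le> norm x} \<le> (LINT x|\<rho>. norm x) / R"
    using int R by (intro integral_Markov_inequality_measure[of _ _ UNIV]) auto
  also have "\<dots> < c"
  proof -
    have "c * R = (LINT x|\<rho>. norm x) + c" using assms by (simp add: R_def distrib_left)
    then show ?thesis using assms R by (simp add: pos_divide_less_eq)
  qed
  finally have small: "measure \<rho> {x. R \<le> norm x} < c" by simp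
  show thesis
  proof (rule that[OF R])
    fix B assume B: "B \<in> sets borel" "c \<le> measure \<rho> B"
    show "\<exists>x\<in>B. norm x \<le> R"
    proof (rule ccontr)
      assume "\<not> ?thesis"
      then have "B \<subseteq> {x. R \<le> norm x}" by auto
      then have "measure \<rho> B \<le> measure \<rho> {x. R \<le> norm x}"
        by (intro finite_measure_mono) auto
      then show False using small B by simp
    qed
  qed
qed

lemma convergent_subsequence_finite_families:
  fixes z :: "nat \<Rightarrow> 'n::finite \<Rightarrow> 'a" and w :: "nat \<Rightarrow> 'n \<Rightarrow> real"
  assumes "\<And>n i. norm (z n i) \<le> C" "\<And>n i. \<bar>w n i\<bar> \<le> C"
  obtains r Z W where "strict_mono r" "\<And>i. (\<lambda>n. z (r n) i) \<longlonglongrightarrow> Z i"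
    "\<And>i. (\<lambda>n. w (r n) i) \<longlonglongrightarrow> W i"
proof -
  define p where "p n = ((\<chi> i. z n i) :: 'a ^ 'n, (\<chi> i. w n i) :: real ^ 'n)" for n
  have "norm (p n) \<le> (\<Sum>i\<in>(UNIV :: 'n set). C) + (\<Sum>i\<in>(UNIV :: 'n set). C)" for n
  proof -
    have "norm (\<chi> i. z n i) \<le> (\<Sum>i\<in>(UNIV :: 'n set). C)"
      unfolding norm_vec_def using assms(1)
      by (intro order.trans[OF L2_set_le_sum sum_mono]) auto
    moreover have "norm (\<chi> i. w n i) \<le> (\<Sum>i\<in>(UNIV :: 'n set). C)"
      unfolding norm_vec_def using assms(2)
      by (intro order.trans[OF L2_set_le_sum sum_mono]) auto
    ultimately show ?thesis
      unfolding p_def using norm_Pair_le by (meson add_mono order.trans)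
  qed
  then have "bounded (range p)" by (intro boundedI) auto
  then obtain l r where r: "strict_mono r" "(p \<circ> r) \<longlonglongrightarrow> l"
    using bounded_imp_convergent_subsequence by blast
  show thesis
  proof (rule that[OF r(1)])
    fix i
    show "(\<lambda>n. z (r n) i) \<longlonglongrightarrow> fst l $ i"
      using tendsto_vec_nth[OF tendsto_fst[OF r(2)], of i] by (simp add: p_def comp_def)
    show "(\<lambda>n. w (r n) i) \<longlonglongrightarrow> snd l $ i"
      using tendsto_vec_nth[OF tendsto_snd[OF r(2)], of i] by (simp add: p_def comp_def)
  qed
qed

text \<open>
  Generators that collapse to a common limit \<open>k\<close> do not separate points in the limit, but they
  still subdivide the limit cell \<open>Q k\<close>; renormalising them inside \<open>Q k\<close> gives the next level of
  the hierarchy.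
\<close>

lemma laguerre_cells_collapse:
  fixes z :: "nat \<Rightarrow> 'n::finite \<Rightarrow> 'a" and w :: "nat \<Rightarrow> 'n \<Rightarrow> real"
  assumes I: "I \<noteq> {}"
    and lim: "\<And>i. (\<lambda>n. z n i) \<longlonglongrightarrow> Z i" "\<And>i. (\<lambda>n. w n i) \<longlonglongrightarrow> W (Z i)"
  defines "Q \<equiv> laguerre_cell (Z ` I) (\<lambda>k. k) W" and "G \<equiv> \<lambda>k. {i \<in> I. Z i = k}"
  shows "AE x in \<rho>. \<exists>k\<in>Z ` I. (\<forall>k'\<in>Z ` I. x \<in> Q k' \<longleftrightarrow> k' = k) \<and>
    (\<forall>\<^sub>F n in sequentially.
      (\<forall>i\<in>G k. x \<in> laguerre_cell I (z n) (w n) i \<longleftrightarrow> x \<in> laguerre_cell (G k) (z n) (w n) i) \<and>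
      (\<forall>i\<in>I - G k. x \<notin> laguerre_cell I (z n) (w n) i))"
proof -
  have "AE x in \<rho>. \<forall>k\<in>Z ` I. \<forall>k'\<in>Z ` I. k \<noteq> k' \<longrightarrow> x \<bullet> k - W k \<noteq> x \<bullet> k' - W k'"
    by (intro AE_generic) auto
  then show ?thesis
  proof eventually_elim
    case (elim x)
    obtain k where k: "k \<in> Z ` I" "\<forall>k'\<in>Z ` I. x \<in> Q k' \<longleftrightarrow> k' = k"
      "\<forall>k'\<in>Z ` I. k' \<noteq> k \<longrightarrow> x \<bullet> k' - W k' < x \<bullet> k - W k"
      using generic_cell[OF _ _ elim] I unfolding Q_def by auto
    \<comment> \<open>Between different groups there is a strict gap at \<open>x\<close> in the
      limit, so for large \<open>n\<close> only generators inside the winning group still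
      compete.\<close>
    have "\<forall>\<^sub>F n in sequentially. x \<bullet> z n j - w n j < x \<bullet> z n i - w n i"
      if "i \<in> G k" "j \<in> I - G k" for i j
    proof -
      have "(\<lambda>n. (x \<bullet> z n j - w n j) - (x \<bullet> z n i - w n i))
          \<longlonglongrightarrow> (x \<bullet> Z j - W (Z j)) - (x \<bullet> Z i - W (Z i))"
        by (intro tendsto_intros lim)
      moreover have "(x \<bullet> Z j - W (Z j)) - (x \<bullet> Z i - W (Z i)) < 0"
        using k(3) that unfolding G_def by auto
      ultimately show ?thesis using order_tendstoD(2) by fastforce
    qed
    then have "\<forall>\<^sub>F n in sequentially. \<forall>i\<in>G k. \<forall>j\<in>I - G k.
        x \<bullet> z n j - w n j < x \<bullet> z n i - w n i"
      by (simp add: eventually_ball_finite_distrib)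
    then have "\<forall>\<^sub>F n in sequentially.
      (\<forall>i\<in>G k. x \<in> laguerre_cell I (z n) (w n) i \<longleftrightarrow> x \<in> laguerre_cell (G k) (z n) (w n) i) \<and>
      (\<forall>i\<in>I - G k. x \<notin> laguerre_cell I (z n) (w n) i)"
    proof eventually_elim
      case (elim n)
      obtain i0 where i0: "i0 \<in> G k" using k(1) unfolding G_def by auto
      have "G k \<subseteq> I" unfolding G_def by auto
      show ?case
      proof (intro conjI ballI)
        fix i assume i: "i \<in> G k"
        then have "\<forall>j\<in>I - G k. x \<bullet> z n j - w n j \<le> x \<bullet> z n i - w n i"
          using elim by (auto intro: less_imp_le)
        then show "x \<in> laguerre_cell I (z n) (w n) i \<longleftrightarrow> x \<in> laguerre_cell (G k) (z n) (w n) i"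
          using \<open>G k \<subseteq> I\<close> unfolding laguerre_cell_def by auto
      next
        fix i assume "i \<in> I - G k"
        then show "x \<notin> laguerre_cell I (z n) (w n) i"
          using elim i0 \<open>G k \<subseteq> I\<close> unfolding laguerre_cell_def by (auto simp: not_le)
      qed
    qed
    with k(1,2) show ?case by blast
  qed
qed

text \<open>The set \<open>A\<close> is the part of space reached at the current level. The uniform
  mass bound inside \<open>A\<close> prevents cells from escaping to infinity and is passed on,
  halved, to each group. Almost every point of \<open>A\<close> is eventually classified as in the
  limit; by dominated convergence this suffices for volumes and barycenters.\<close>

lemma laguerre_cells_limit:
  fixes y :: "nat \<Rightarrow> 'n::finite \<Rightarrow> 'a" and \<phi> :: "nat \<Rightarrow> 'n \<Rightarrow> real"
  assumes "I \<noteq> {}" "\<And>n. inj_on (y n) I" "A \<in> sets borel" "0 < c"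
    and "\<And>n i. i \<in> I \<Longrightarrow> c \<le> measure \<rho> (A \<inter> laguerre_cell I (y n) (\<phi> n) i)"
  shows "\<exists>r P. strict_mono (r :: nat \<Rightarrow> nat) \<and> hierarchical_on I P \<and>
    (AE x in \<rho>. x \<in> A \<longrightarrow> (\<forall>i\<in>I. \<forall>\<^sub>F n in sequentially.
      x \<in> laguerre_cell I (y (r n)) (\<phi> (r n)) i \<longleftrightarrow> x \<in> P i))"
  using assms
proof (induction I arbitrary: y \<phi> A c rule: measure_induct_rule[where f = card])
  case (less I)
  obtain i0 where i0: "i0 \<in> I" using less.prems(1) by auto
  show ?case
  proof (cases "I = {i0}")
    case True
    then show ?thesis
      using hierarchical_on_singleton[of i0] strict_mono_id
      by (intro exI[of _ id] exI[of _ "\<lambda>_. UNIV"]) (auto simp: laguerre_cell_singleton)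
  next
    case False
    then obtain j0 where j0: "j0 \<in> I" "j0 \<noteq> i0" using i0 by auto
    define d where "d n = (\<Sum>i\<in>I. norm (y n i - y n i0))" for n
    \<comment> \<open>The value 0 outside \<open>I\<close> keeps the families bounded on the whole
      index type, where the compactness argument is applied.\<close>
    define z where "z n i = (if i \<in> I then (y n i - y n i0) /\<^sub>R d n else 0)" for n i
    define w where "w n i = (if i \<in> I then (\<phi> n i - \<phi> n i0) / d n else 0)" for n i
    have d: "d n > 0" for n
    proof -
      have "y n j0 \<noteq> y n i0" using less.prems(2)[of n] i0 j0 by (auto dest: inj_onD)
      then show ?thesis
        unfolding d_def using j0(1) by (intro sum_pos2[of _ j0]) auto
    qed
    have cells: "laguerre_cell I (z n) (w n) i = laguerre_cell I (y n) (\<phi> n) i" if "i \<in> I" for n i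
      using that by (intro laguerre_cell_normalize[OF d]) (auto simp: z_def w_def)
    have z_inj: "inj_on (z n) I" for n
      using less.prems(2)[of n] d[of n] by (auto simp: inj_on_def z_def)
    have z_sum: "(\<Sum>i\<in>I. norm (z n i)) = 1" for n
    proof -
      have "(\<Sum>i\<in>I. norm (z n i)) = (\<Sum>i\<in>I. norm (y n i - y n i0) / d n)"
        using d[of n] by (intro sum.cong) (auto simp: z_def divide_inverse mult.commute)
      also have "\<dots> = 1"
        using d[of n] by (simp add: d_def flip: sum_divide_distrib)
      finally show ?thesis .
    qed
    obtain R where R: "0 < R"
      "\<And>B. B \<in> sets borel \<Longrightarrow> c \<le> measure \<rho> B \<Longrightarrow> \<exists>x\<in>B. norm x \<le> R"
      using norm_tail_small[OF less.prems(4)] by blast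
    \<comment> \<open>A point of cell \<open>i\<close> in the ball of radius \<open>R\<close> turns
      its defining inequality into this estimate. With \<open>j = i0\<close> it bounds the weights;
      in the limit it gives equal weights to generators that collapse together.\<close>
    have w_le: "w n i - w n j \<le> R * norm (z n i - z n j)" if ij: "i \<in> I" "j \<in> I" for n i j
    proof -
      obtain x where x: "x \<in> A \<inter> laguerre_cell I (y n) (\<phi> n) i" "norm x \<le> R"
        using R(2)[of "A \<inter> laguerre_cell I (y n) (\<phi> n) i"] less.prems(3,5) ij(1) by auto
      have "x \<bullet> z n j - w n j \<le> x \<bullet> z n i - w n i"
        using x(1) ij unfolding cells[OF ij(1), symmetric]
        by (cases "j = i") (auto simp: laguerre_cell_def)
      then have "w n i - w n j \<le> x \<bullet> (z n i - z n j)" by (simp add: inner_diff_right)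
      also have "\<dots> \<le> norm x * norm (z n i - z n j)" by (rule norm_cauchy_schwarz)
      also have "\<dots> \<le> R * norm (z n i - z n j)" using x(2) by (intro mult_right_mono) auto
      finally show ?thesis .
    qed
    have z_bd: "norm (z n i) \<le> 1" for n i
    proof (cases "i \<in> I")
      case True
      then show ?thesis using member_le_sum[of i I "\<lambda>i. norm (z n i)"] z_sum[of n] by simp
    qed (simp add: z_def)
    have z0: "z n i0 = 0" "w n i0 = 0" for n using i0 by (auto simp: z_def w_def)
    have w_bd: "\<bar>w n i\<bar> \<le> R" for n i
    proof (cases "i \<in> I")
      case True
      have "\<bar>w n i\<bar> \<le> R * norm (z n i)"
        using w_le[OF True i0, of n] w_le[OF i0 True, of n] z0 by (simp add: abs_le_iff)
      also have "\<dots> \<le> R" using z_bd R(1) by (simp add: mult_left_le)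
      finally show ?thesis .
    qed (use R(1) in \<open>simp add: w_def\<close>)
    obtain r0 Z W' where r0: "strict_mono r0"
      and Z: "\<And>i. (\<lambda>n. z (r0 n) i) \<longlonglongrightarrow> Z i" and W': "\<And>i. (\<lambda>n. w (r0 n) i) \<longlonglongrightarrow> W' i"
      using convergent_subsequence_finite_families[of z "max 1 R" w] z_bd w_bd
      by (metis max.coboundedI1 max.coboundedI2)
    have W'_eq: "W' i = W' j" if ij: "i \<in> I" "j \<in> I" "Z i = Z j" for i j
    proof -
      have "W' i - W' j \<le> R * norm (Z i - Z j)" if "i \<in> I" "j \<in> I" for i j
        using w_le[OF that]
        by (intro LIMSEQ_le[OF tendsto_diff[OF W' W'] tendsto_mult_left[OF tendsto_norm[OF tendsto_diff[OF Z Z]]]]) auto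
      from this[OF ij(1,2)] this[OF ij(2,1)] show ?thesis using ij(3) by simp
    qed
    \<comment> \<open>By \<open>W'_eq\<close> the limit weight depends only on the limit generator,
      so any representative may be chosen.\<close>
    define W where "W k = (if k \<in> Z ` I then W' (inv_into I Z k) else 0)" for k
    have W: "W (Z i) = W' i" if "i \<in> I" for i
      unfolding W_def using that inv_into_into[of "Z i" Z I] f_inv_into_f[of "Z i" Z I]
      by (auto intro!: W'_eq)
    have Z_out: "Z i = 0" "W' i = 0" if "i \<notin> I" for i
      using Z[of i] W'[of i] that by (auto simp: z_def w_def LIMSEQ_const_iff)
    have W_lim: "(\<lambda>n. w (r0 n) i) \<longlonglongrightarrow> W (Z i)" for i
    \<comment> \<open>A label outside \<open>I\<close> has limits 0, the same as \<open>i0\<close>,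
      so the value of \<open>W\<close> at its limit generator is also right.\<close>
    proof (cases "i \<in> I")
      case False
      have "Z i0 = 0" "W' i0 = 0" using Z[of i0] W'[of i0] by (auto simp: z0 LIMSEQ_const_iff)
      then have "W (Z i) = W' i" using False Z_out W[OF i0] by simp
      then show ?thesis using W' by simp
    qed (use W W' in simp)
    define Q where "Q = laguerre_cell (Z ` I) (\<lambda>k. k) W"
    define G where "G k = {i \<in> I. Z i = k}" for k
    define L where "L n = laguerre_cell I (z (r0 n)) (w (r0 n))" for n
    define M where "M k n = laguerre_cell (G k) (z (r0 n)) (w (r0 n))" for k n
    have Q_borel: "Q k \<in> sets borel" for k unfolding Q_def by (rule laguerre_cell_borel)
    have collapse: "AE x in \<rho>. \<exists>k\<in>Z ` I. (\<forall>k'\<in>Z ` I. x \<in> Q k' \<longleftrightarrow> k' = k) \<and>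
      (\<forall>\<^sub>F n in sequentially. (\<forall>i\<in>G k. x \<in> L n i \<longleftrightarrow> x \<in> M k n i) \<and> (\<forall>i\<in>I - G k. x \<notin> L n i))"
      unfolding Q_def G_def L_def M_def
      by (rule laguerre_cells_collapse[of I "\<lambda>n. z (r0 n)" Z "\<lambda>n. w (r0 n)" W,
            OF less.prems(1) Z W_lim])
    \<comment> \<open>If all limits coincided they would equal the limit 0 of \<open>i0\<close>, but
      the norms still sum to 1 in the limit.\<close>
    have card_G: "card (G k) < card I" for k
    proof -
      have "\<exists>i\<in>I. Z i \<noteq> k"
      proof (rule ccontr)
        assume "\<not> ?thesis"
        moreover have "Z i0 = 0" using Z[of i0] by (simp add: z0 LIMSEQ_const_iff)
        ultimately have "(\<Sum>i\<in>I. norm (Z i)) = 0" using i0 by auto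
        moreover have "(\<lambda>n. \<Sum>i\<in>I. norm (z (r0 n) i)) \<longlonglongrightarrow> (\<Sum>i\<in>I. norm (Z i))"
          by (intro tendsto_intros Z)
        ultimately show False by (simp add: z_sum LIMSEQ_const_iff)
      qed
      then show ?thesis unfolding G_def by (intro psubset_card_mono) auto
    qed
    define good where "good k s \<longleftrightarrow> (\<exists>P. hierarchical_on (G k) P \<and> (AE x in \<rho>. x \<in> A \<inter> Q k \<longrightarrow>
      (\<forall>i\<in>G k. \<forall>\<^sub>F n in sequentially. x \<in> M k (s n) i \<longleftrightarrow> x \<in> P i)))" for k and s :: "nat \<Rightarrow> nat"
    \<comment> \<open>The part of cell \<open>i\<close> lost by passing to \<open>Q k\<close> and to
      the subtessellation of \<open>G k\<close> has measure tending to 0, so half of the mass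
      remains eventually.\<close>
    have mass: "\<forall>\<^sub>F n in sequentially. \<forall>i\<in>G k. c / 2 \<le> measure \<rho> (A \<inter> Q k \<inter> M k n i)"
      if k: "k \<in> Z ` I" for k
    proof -
      have "\<forall>\<^sub>F n in sequentially. c / 2 \<le> measure \<rho> (A \<inter> Q k \<inter> M k n i)" if i: "i \<in> G k" for i
      proof -
        define U where "U n = A \<inter> L n i - A \<inter> Q k \<inter> M k n i" for n
        have U: "U n \<in> sets borel" for n
          unfolding U_def L_def M_def using less.prems(3) Q_borel by auto
        have "(\<lambda>n. measure \<rho> (U n)) \<longlonglongrightarrow> measure \<rho> {}"
        proof (rule measure_tendsto[OF U])
          show "AE x in \<rho>. \<forall>\<^sub>F n in sequentially. x \<in> U n \<longleftrightarrow> x \<in> {}"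
            using collapse
          proof eventually_elim
            case (elim x)
            then obtain k' where k': "k' \<in> Z ` I" "\<forall>k\<in>Z ` I. x \<in> Q k \<longleftrightarrow> k = k'"
              "\<forall>\<^sub>F n in sequentially. (\<forall>i\<in>G k'. x \<in> L n i \<longleftrightarrow> x \<in> M k' n i) \<and> (\<forall>i\<in>I - G k'. x \<notin> L n i)"
              by blast
            from k'(3) show ?case
            proof eventually_elim
              case (elim n)
              then show ?case
                using k'(2) k i unfolding U_def by (cases "k' = k") (auto simp: G_def)
            qed
          qed
        qed auto
        from order_tendstoD(2)[OF this, of "c / 2"]
        have "\<forall>\<^sub>F n in sequentially. measure \<rho> (U n) < c / 2"
          using less.prems(4) by simp
        then show ?thesis
        proof eventually_elim
          case (elim n)
          have AM: "A \<inter> Q k \<inter> M k n i \<in> sets borel"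
            unfolding M_def using less.prems(3) Q_borel by auto
          have "c \<le> measure \<rho> (A \<inter> L n i)"
            unfolding L_def using i less.prems(5) cells by (auto simp: G_def)
          also have "\<dots> \<le> measure \<rho> (U n \<union> (A \<inter> Q k \<inter> M k n i))"
          proof (rule finite_measure_mono)
            show "A \<inter> L n i \<subseteq> U n \<union> (A \<inter> Q k \<inter> M k n i)" unfolding U_def by blast
            show "U n \<union> (A \<inter> Q k \<inter> M k n i) \<in> sets \<rho>" using U[of n] AM by simp
          qed
          also have "\<dots> \<le> measure \<rho> (U n) + measure \<rho> (A \<inter> Q k \<inter> M k n i)"
            using U[of n] AM by (intro measure_Un_le) simp_all
          finally show ?case using elim by simp
        qed
      qed
      then show ?thesis by (simp add: eventually_ball_finite_distrib)
    qed
    have ex: "\<exists>r. strict_mono r \<and> good k (s \<circ> r)" if k: "k \<in> Z ` I" and s: "strict_mono s" for k and s :: "nat \<Rightarrow> nat"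
    proof -
      \<comment> \<open>The mass bound holds only from \<open>N\<close> on, while the induction
        hypothesis wants it for all indices; hence the shift by \<open>N\<close> below.\<close>
      obtain N where N: "\<And>n i. n \<ge> N \<Longrightarrow> i \<in> G k \<Longrightarrow> c / 2 \<le> measure \<rho> (A \<inter> Q k \<inter> M k n i)"
        using mass[OF k] unfolding eventually_sequentially by blast
      have "G k \<noteq> {}" "G k \<subseteq> I" using k unfolding G_def by auto
      moreover have "inj_on (z (r0 (s (n + N)))) (G k)" for n
        using z_inj \<open>G k \<subseteq> I\<close> by (rule inj_on_subset)
      moreover have "A \<inter> Q k \<in> sets borel" using less.prems(3) Q_borel by auto
      moreover have "0 < c / 2" using less.prems(4) by simp
      moreover have "c / 2 \<le> measure \<rho> (A \<inter> Q k \<inter> M k (s (n + N)) i)" if "i \<in> G k" for n i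
        using seq_suble[OF s, of "n + N"] that by (intro N) auto
      ultimately have "\<exists>r P. strict_mono (r :: nat \<Rightarrow> nat) \<and> hierarchical_on (G k) P \<and>
          (AE x in \<rho>. x \<in> A \<inter> Q k \<longrightarrow> (\<forall>i\<in>G k. \<forall>\<^sub>F n in sequentially.
            x \<in> M k (s (r n + N)) i \<longleftrightarrow> x \<in> P i))"
        unfolding M_def
        using less.IH[OF card_G, of k "\<lambda>n. z (r0 (s (n + N)))" "A \<inter> Q k" "c / 2"
          "\<lambda>n. w (r0 (s (n + N)))"] by blast
      then obtain r P where r: "strict_mono (r :: nat \<Rightarrow> nat)" "hierarchical_on (G k) P"
        "AE x in \<rho>. x \<in> A \<inter> Q k \<longrightarrow> (\<forall>i\<in>G k. \<forall>\<^sub>F n in sequentially.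
          x \<in> M k (s (r n + N)) i \<longleftrightarrow> x \<in> P i)"
        by blast
      have "strict_mono (\<lambda>n. r n + N)" using r(1) by (simp add: strict_mono_def)
      then show ?thesis
        using r(2,3) unfolding good_def by (intro exI[of _ "\<lambda>n. r n + N"]) auto
    qed
    have sub: "good k (s \<circ> r)" if good: "good k s" and r: "strict_mono r" for k s r
    proof -
      obtain P where P: "hierarchical_on (G k) P" "AE x in \<rho>. x \<in> A \<inter> Q k \<longrightarrow>
          (\<forall>i\<in>G k. \<forall>\<^sub>F n in sequentially. x \<in> M k (s n) i \<longleftrightarrow> x \<in> P i)"
        using good unfolding good_def by blast
      from P(2) have "AE x in \<rho>. x \<in> A \<inter> Q k \<longrightarrow>
          (\<forall>i\<in>G k. \<forall>\<^sub>F n in sequentially. x \<in> M k ((s \<circ> r) n) i \<longleftrightarrow> x \<in> P i)"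
        by eventually_elim (auto dest: eventually_subseq[OF r])
      then show ?thesis using P(1) unfolding good_def by blast
    qed
    have "\<exists>r. strict_mono r \<and> (\<forall>k\<in>Z ` I. good k r)"
      by (rule common_subsequence) (simp, erule (1) ex, erule (1) sub)
    then obtain r1 where r1: "strict_mono r1" "\<And>k. k \<in> Z ` I \<Longrightarrow> good k r1"
      by blast
    from r1(2) have "\<forall>k\<in>Z ` I. \<exists>P. hierarchical_on (G k) P \<and> (AE x in \<rho>. x \<in> A \<inter> Q k \<longrightarrow>
        (\<forall>i\<in>G k. \<forall>\<^sub>F n in sequentially. x \<in> M k (r1 n) i \<longleftrightarrow> x \<in> P i))"
      unfolding good_def by blast
    from bchoice[OF this] obtain P where P': "\<forall>k\<in>Z ` I. hierarchical_on (G k) (P k) \<and>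
        (AE x in \<rho>. x \<in> A \<inter> Q k \<longrightarrow>
          (\<forall>i\<in>G k. \<forall>\<^sub>F n in sequentially. x \<in> M k (r1 n) i \<longleftrightarrow> x \<in> P k i))" ..
    have P: "hierarchical_on (G k) (P k)" if "k \<in> Z ` I" for k
      using bspec[OF P' that] ..
    have P_lim: "AE x in \<rho>. x \<in> A \<inter> Q k \<longrightarrow>
        (\<forall>i\<in>G k. \<forall>\<^sub>F n in sequentially. x \<in> M k (r1 n) i \<longleftrightarrow> x \<in> P k i)" if "k \<in> Z ` I" for k
      using bspec[OF P' that] ..
    have "laguerre_tessellation (Z ` I) Q"
      unfolding laguerre_tessellation_def Q_def by (auto intro: exI[of _ "\<lambda>k. k"])
    then have "hierarchical_on I (\<lambda>i. Q (Z i) \<inter> P (Z i) i)"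
      using less.prems(1) P unfolding G_def by (intro hierarchical_on_refine) auto
    moreover have "strict_mono (r0 \<circ> r1)" using r0 r1(1) by (rule strict_mono_o)
    moreover have "AE x in \<rho>. x \<in> A \<longrightarrow> (\<forall>i\<in>I. \<forall>\<^sub>F n in sequentially.
        x \<in> laguerre_cell I (y ((r0 \<circ> r1) n)) (\<phi> ((r0 \<circ> r1) n)) i \<longleftrightarrow> x \<in> Q (Z i) \<inter> P (Z i) i)"
    proof -
      have "AE x in \<rho>. \<forall>k\<in>Z ` I. x \<in> A \<inter> Q k \<longrightarrow>
        (\<forall>i\<in>G k. \<forall>\<^sub>F n in sequentially. x \<in> M k (r1 n) i \<longleftrightarrow> x \<in> P k i)"
        by (intro AE_finite_allI P_lim) auto
      with collapse show ?thesis
      proof eventually_elim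
        case (elim x)
        then obtain k where k: "k \<in> Z ` I" "\<forall>k'\<in>Z ` I. x \<in> Q k' \<longleftrightarrow> k' = k"
          "\<forall>\<^sub>F n in sequentially. (\<forall>i\<in>G k. x \<in> L n i \<longleftrightarrow> x \<in> M k n i) \<and> (\<forall>i\<in>I - G k. x \<notin> L n i)"
          by blast
        have ev: "\<forall>\<^sub>F n in sequentially. (\<forall>i\<in>G k. x \<in> L (r1 n) i \<longleftrightarrow> x \<in> M k (r1 n) i) \<and>
            (\<forall>i\<in>I - G k. x \<notin> L (r1 n) i)"
          using eventually_subseq[OF r1(1) k(3)] .
        show ?case
        proof (intro impI ballI)
          fix i assume "x \<in> A" and i: "i \<in> I"
          have L_eq: "laguerre_cell I (y ((r0 \<circ> r1) n)) (\<phi> ((r0 \<circ> r1) n)) i = L (r1 n) i" for n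
            unfolding L_def using cells[OF i] by simp
          show "\<forall>\<^sub>F n in sequentially.
              x \<in> laguerre_cell I (y ((r0 \<circ> r1) n)) (\<phi> ((r0 \<circ> r1) n)) i \<longleftrightarrow> x \<in> Q (Z i) \<inter> P (Z i) i"
            unfolding L_eq
          proof (cases "Z i = k")
            case True
            then have "i \<in> G k" using i unfolding G_def by simp
            have xQ: "x \<in> Q k" using k(1,2) by blast
            then have "\<forall>\<^sub>F n in sequentially. x \<in> M k (r1 n) i \<longleftrightarrow> x \<in> P k i"
              using bspec[OF elim(2) k(1)] xQ \<open>x \<in> A\<close> \<open>i \<in> G k\<close> by blast
            with ev show "\<forall>\<^sub>F n in sequentially. x \<in> L (r1 n) i \<longleftrightarrow> x \<in> Q (Z i) \<inter> P (Z i) i"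
              by eventually_elim (use True xQ \<open>i \<in> G k\<close> in blast)
          next
            case False
            then have "i \<in> I - G k" "x \<notin> Q (Z i)" using i k(2) unfolding G_def by auto
            from ev show "\<forall>\<^sub>F n in sequentially. x \<in> L (r1 n) i \<longleftrightarrow> x \<in> Q (Z i) \<inter> P (Z i) i"
              by eventually_elim (use \<open>i \<in> I - G k\<close> \<open>x \<notin> Q (Z i)\<close> in blast)
          qed
        qed
      qed
    qed
    ultimately show ?thesis
      by (intro exI[of _ "r0 \<circ> r1"] exI[of _ "\<lambda>i. Q (Z i) \<inter> P (Z i) i"] conjI)
  qed
qed

end

section \<open>The set of dominated barycenters\<close>

lemma ext_integral_eq_integral:
  assumes "integrable M f"
  shows "ext_integral M f = ereal (LINT x|M. f x)"
proof -
  have fin: "(\<integral>\<^sup>+ x. ennreal (f x) \<partial>M) \<noteq> \<infinity>" "(\<integral>\<^sup>+ x. ennreal (- f x) \<partial>M) \<noteq> \<infinity>"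
    using assms by (auto simp: real_integrable_def)
  have "enn2ereal a = ereal (enn2real a)" if "a \<noteq> \<infinity>" for a
    using that by (cases a) (auto simp: enn2ereal_ennreal)
  then show ?thesis
    using fin assms by (simp add: ext_integral_def real_lebesgue_integral_def)
qed

lemma ext_integral_mono:
  assumes "\<And>x. f x \<le> g x"
  shows "ext_integral M f \<le> ext_integral M g"
  unfolding ext_integral_def
proof (rule ereal_minus_mono)
  show "enn2ereal (\<integral>\<^sup>+ x. ennreal (f x) \<partial>M) \<le> enn2ereal (\<integral>\<^sup>+ x. ennreal (g x) \<partial>M)"
    using assms by (auto simp flip: less_eq_ennreal.rep_eq intro!: nn_integral_mono ennreal_leI)
  show "enn2ereal (\<integral>\<^sup>+ x. ennreal (- g x) \<partial>M) \<le> enn2ereal (\<integral>\<^sup>+ x. ennreal (- f x) \<partial>M)"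
    using assms by (auto simp flip: less_eq_ennreal.rep_eq intro!: nn_integral_mono ennreal_leI)
qed

lemma convex_on_borel_measurable:
  fixes \<phi> :: "'a::euclidean_space \<Rightarrow> real"
  assumes "convex_on UNIV \<phi>"
  shows "\<phi> \<in> borel_measurable borel"
  using convex_on_continuous[OF open_UNIV assms] by (rule borel_measurable_continuous_onI)

lemma ext_integral_weighted_diracs:
  assumes "\<And>i. 0 \<le> v $ i" "convex_on UNIV \<phi>"
  shows "ext_integral (weighted_diracs v B) \<phi> = ereal (\<Sum>i\<in>UNIV. v $ i * \<phi> (B $ i))"
proof -
  have \<phi>: "\<phi> \<in> borel_measurable borel" using assms(2) by (rule convex_on_borel_measurable)
  have int: "integrable (point_measure UNIV (\<lambda>i. ennreal (v $ i))) (\<lambda>i. \<phi> (B $ i))"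
    by (rule integrable_point_measure_finite) simp
  have "integrable (weighted_diracs v B) \<phi>"
    unfolding weighted_diracs_def using int \<phi>
    by (subst integrable_distr_eq) (auto simp: space_point_measure)
  moreover have "(LINT x|weighted_diracs v B. \<phi> x) = (\<Sum>i\<in>UNIV. v $ i * \<phi> (B $ i))"
    unfolding weighted_diracs_def using \<phi> assms(1)
    by (subst integral_distr) (auto simp: lebesgue_integral_point_measure_finite)
  ultimately show ?thesis by (simp add: ext_integral_eq_integral)
qed

lemma convex_dominated_barycenters:
  fixes v :: "real ^ 'n" and \<rho> :: "'a::euclidean_space measure"
  assumes v: "\<And>i. 0 \<le> v $ i"
  shows "convex (dominated_barycenters v \<rho>)"
proof (rule convexI)
  fix B B' and s t :: real
  assume B: "B \<in> dominated_barycenters v \<rho>" "B' \<in> dominated_barycenters v \<rho>"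
    and st: "0 \<le> s" "0 \<le> t" "s + t = 1"
  show "s *\<^sub>R B + t *\<^sub>R B' \<in> dominated_barycenters v \<rho>"
    unfolding dominated_barycenters_def convex_order_def mem_Collect_eq
  proof (intro allI impI)
    fix \<phi> :: "'a \<Rightarrow> real" assume \<phi>: "convex_on UNIV \<phi>"
    define f where "f B = (\<Sum>i\<in>UNIV. v $ i * \<phi> (B $ i))" for B
    have le: "ereal (f C) \<le> ext_integral \<rho> \<phi>" if "C \<in> dominated_barycenters v \<rho>" for C
      using that \<phi> ext_integral_weighted_diracs[OF v \<phi>, of C]
      unfolding f_def dominated_barycenters_def convex_order_def by auto
    have "f (s *\<^sub>R B + t *\<^sub>R B') \<le> s * f B + t * f B'"
      unfolding f_def sum_distrib_left sum.distrib[symmetric]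
    proof (rule sum_mono)
      fix i
      have "\<phi> (s *\<^sub>R B $ i + t *\<^sub>R B' $ i) \<le> s * \<phi> (B $ i) + t * \<phi> (B' $ i)"
        using \<phi> st unfolding convex_on_def by blast
      then have "v $ i * \<phi> (s *\<^sub>R B $ i + t *\<^sub>R B' $ i)
          \<le> v $ i * (s * \<phi> (B $ i) + t * \<phi> (B' $ i))"
        using v by (rule mult_left_mono)
      then show "v $ i * \<phi> ((s *\<^sub>R B + t *\<^sub>R B') $ i)
          \<le> s * (v $ i * \<phi> (B $ i)) + t * (v $ i * \<phi> (B' $ i))"
        by (simp add: algebra_simps)
    qed
    \<comment> \<open>Comparing with the larger of two real values avoids convex combinations of the
      right-hand side, which may be infinite.\<close>
    also have "\<dots> \<le> max (f B) (f B')"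
      using st by (intro convex_bound_le) auto
    finally have "ereal (f (s *\<^sub>R B + t *\<^sub>R B')) \<le> ext_integral \<rho> \<phi>"
      using le[OF B(1)] le[OF B(2)] by (metis ereal_less_eq(3) max_def order.trans)
    then show "ext_integral (weighted_diracs v (s *\<^sub>R B + t *\<^sub>R B')) \<phi> \<le> ext_integral \<rho> \<phi>"
      unfolding f_def by (simp add: ext_integral_weighted_diracs[OF v \<phi>])
  qed
qed

text \<open>A collision of two labels is an equation of degree one in \<open>t\<close> with nonzero
  coefficient \<open>e i - e j\<close>, so each pair excludes at most one value of
  \<open>t\<close>.\<close>

lemma exists_inj_perturbation:
  fixes y e :: "'n::finite \<Rightarrow> 'a::real_vector"
  assumes "inj e" "0 < \<epsilon>"
  shows "\<exists>t. 0 < t \<and> t < (\<epsilon>::real) \<and> inj (\<lambda>i. y i + t *\<^sub>R e i)"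
proof -
  define T where "T i j = {t. i \<noteq> j \<and> y i + t *\<^sub>R e i = y j + t *\<^sub>R e j}" for i j
  have "finite (T i j)" for i j
  proof (cases "T i j = {}")
    case False
    then obtain s where s: "s \<in> T i j" by auto
    have "t = s" if t: "t \<in> T i j" for t
    proof -
      have "s *\<^sub>R (e i - e j) = y j - y i" "t *\<^sub>R (e i - e j) = y j - y i"
        using s t unfolding T_def by (simp_all add: algebra_simps)
      then have "(t - s) *\<^sub>R (e i - e j) = 0" by (simp add: scaleR_left_diff_distrib)
      moreover have "e i \<noteq> e j" using s assms(1) unfolding T_def by (auto dest: injD)
      ultimately show ?thesis by simp
    qed
    then show ?thesis by (intro finite_subset[of "T i j" "{s}"]) auto
  qed simp
  then have "finite (\<Union>i. \<Union>j. T i j)" by auto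
  moreover have "infinite {0<..<\<epsilon>}" using assms(2) by (simp add: infinite_Ioo)
  ultimately obtain t where "t \<in> {0<..<\<epsilon>}" "t \<notin> (\<Union>i. \<Union>j. T i j)"
    by (metis finite_subset subsetI)
  then show ?thesis unfolding T_def by (intro exI[of _ t]) (auto simp: inj_on_def)
qed

lemma exists_inj_finite_euclidean: "\<exists>e :: 'n::finite \<Rightarrow> 'a::euclidean_space. inj e"
proof -
  obtain f :: "'n \<Rightarrow> nat" where f: "inj f"
    using finite_imp_inj_to_nat_seg[of "UNIV :: 'n set"] by auto
  obtain b :: 'a where "b \<in> Basis" using nonempty_Basis by blast
  then have "inj (\<lambda>i. real (f i) *\<^sub>R b)"
    using f nonzero_Basis by (auto simp: inj_on_def)
  then show ?thesis by blast
qed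

section \<open>The cycle of inclusions between barycenter sets and extreme points\<close>

context hyperplane_null_measure
begin

lemma dominated_barycentersD:
  assumes "\<And>i. 0 \<le> v $ i" "B \<in> dominated_barycenters v \<rho>"
  shows "dominated (($) v) UNIV UNIV (($) B)"
  unfolding dominated_def
proof (intro allI impI)
  fix \<psi> :: "'a \<Rightarrow> real" assume \<psi>: "convex_on UNIV \<psi>" "integrable \<rho> \<psi>"
  then have "ext_integral (weighted_diracs v B) \<psi> \<le> ext_integral \<rho> \<psi>"
    using assms(2) unfolding dominated_barycenters_def convex_order_def by blast
  then show "(\<Sum>i\<in>UNIV. v $ i * \<psi> (B $ i)) \<le> (LINT x:UNIV|\<rho>. \<psi> x)"
    using \<psi> ext_integral_weighted_diracs[OF assms(1) \<psi>(1)]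
    by (simp add: ext_integral_eq_integral set_lebesgue_integral_def)
qed

lemma has_volumes_barycentersD:
  assumes "\<And>i. 0 < v $ i" "has_volumes_barycenters v \<rho> L B"
  shows "measure \<rho> (L i) = v $ i" "v $ i *\<^sub>R B $ i = (LINT x:L i|\<rho>. x)"
  using assms(2) less_imp_neq[OF assms(1)[of i]] unfolding has_volumes_barycenters_def by auto

text \<open>Jensen's inequality on each cell, by supporting affine functions of \<phi> at the
  barycenters. Since \<phi> itself may fail to be integrable, the cell integrals are assembled for
  the maximum \<open>m\<close> of these supports, an integrable minorant of \<phi>.\<close>

lemma B_hLag_subset_dominated:
  assumes v: "\<And>i. 0 < v $ i"
  shows "B_hLag v \<rho> \<subseteq> dominated_barycenters v \<rho>"
proof
  fix B assume "B \<in> B_hLag v \<rho>"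
  then obtain L Ps \<sigma> where vb: "has_volumes_barycenters v \<rho> L B"
    and Ps: "hierarchical_cells Ps" "bij_betw \<sigma> UNIV {..<length Ps}" "\<And>i. L i = Ps ! \<sigma> i"
    unfolding B_hLag_def hierarchical_laguerre_tessellation_def by blast
  have L: "L i \<in> sets borel" for i
    using hierarchical_cells_borel[OF Ps(1)] bij_betwE[OF Ps(2)] Ps(3) by auto
  show "B \<in> dominated_barycenters v \<rho>"
    unfolding dominated_barycenters_def convex_order_def mem_Collect_eq
  proof (intro allI impI)
    fix \<phi> :: "'a \<Rightarrow> real" assume \<phi>: "convex_on UNIV \<phi>"
    have "\<exists>p. \<forall>x. \<phi> (B $ i) + (x - B $ i) \<bullet> p \<le> \<phi> x" for i
      using convex_on_subgradient[OF \<phi>] by blast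
    then obtain p where p: "\<And>i x. \<phi> (B $ i) + (x - B $ i) \<bullet> p i \<le> \<phi> x"
      by metis
    define c where "c i = B $ i \<bullet> p i - \<phi> (B $ i)" for i
    define m where "m x = Max (range (\<lambda>i. x \<bullet> p i - c i))" for x
    have m_int: "integrable \<rho> m"
      unfolding m_def by (intro integrable_Max) auto
    have "(\<Sum>i\<in>UNIV. v $ i * \<phi> (B $ i)) = (\<Sum>i\<in>UNIV. LINT x:L i|\<rho>. x \<bullet> p i - c i)"
    proof (intro sum.cong refl)
      fix i
      have "(LINT x:L i|\<rho>. x \<bullet> p i - c i) = (v $ i *\<^sub>R B $ i) \<bullet> p i - c i * v $ i"
        using has_volumes_barycentersD[OF v vb] by (simp add: set_integral_affine[OF L])
      then show "v $ i * \<phi> (B $ i) = (LINT x:L i|\<rho>. x \<bullet> p i - c i)"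
        by (simp add: c_def algebra_simps)
    qed
    also have "\<dots> \<le> (\<Sum>i\<in>UNIV. LINT x:L i|\<rho>. m x)"
    proof (intro sum_mono set_integral_mono)
      fix i x
      show "x \<bullet> p i - c i \<le> m x" unfolding m_def by (intro Max_ge) auto
    qed (use L m_int in \<open>auto intro!: set_integrable_borel\<close>)
    also have "\<dots> = (\<Sum>k<length Ps. LINT x:Ps ! k|\<rho>. m x)"
      unfolding Ps(3) by (rule sum.reindex_bij_betw[OF Ps(2)])
    also have "\<dots> = (LINT x|\<rho>. m x)"
      using integral_hierarchical_cells[OF Ps(1) m_int]
      by (simp add: sum_list_sum_nth atLeast0LessThan)
    finally have "ext_integral (weighted_diracs v B) \<phi> \<le> ext_integral \<rho> m"
      using v by (simp add: ext_integral_weighted_diracs[OF _ \<phi>] less_imp_le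
          ext_integral_eq_integral[OF m_int])
    also have "\<dots> \<le> ext_integral \<rho> \<phi>"
    proof (rule ext_integral_mono)
      fix x
      have "x \<bullet> p i - c i \<le> \<phi> x" for i
        using p[of i x] by (simp add: c_def inner_diff_left)
      then show "m x \<le> \<phi> x" unfolding m_def by (intro Max.boundedI) auto
    qed
    finally show "ext_integral (weighted_diracs v B) \<phi> \<le> ext_integral \<rho> \<phi>" .
  qed
qed

lemma B_hLag_extreme:
  assumes v: "\<And>i. 0 < v $ i" and B: "B \<in> B_hLag v \<rho>"
  shows "B extreme_point_of dominated_barycenters v \<rho>"
  unfolding extreme_point_of_def
proof (intro conjI ballI notI)
  show "B \<in> dominated_barycenters v \<rho>" using B_hLag_subset_dominated[OF v] B by blast
  fix B' B'' assume B': "B' \<in> dominated_barycenters v \<rho>" and B'': "B'' \<in> dominated_barycenters v \<rho>"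
    and "B \<in> open_segment B' B''"
  then obtain t where "B' \<noteq> B''" and t: "0 < t" "t < 1" "B = (1 - t) *\<^sub>R B' + t *\<^sub>R B''"
    by (auto simp: in_segment)
  obtain L Ps \<sigma> where vb: "has_volumes_barycenters v \<rho> L B"
    and Ps: "hierarchical_cells Ps" "bij_betw \<sigma> UNIV {..<length Ps}" "\<And>i. L i = Ps ! \<sigma> i"
    using B unfolding B_hLag_def hierarchical_laguerre_tessellation_def by blast
  define \<tau> where "\<tau> = inv_into UNIV \<sigma>"
  have \<tau>: "\<sigma> (\<tau> k) = k" if "k < length Ps" for k
    using that Ps(2) by (auto simp: \<tau>_def bij_betw_def f_inv_into_f)
  have \<sigma>: "\<tau> (\<sigma> i) = i" "\<sigma> i < length Ps" for i
    using Ps(2) bij_betwE[OF Ps(2)] by (auto simp: \<tau>_def bij_betw_def)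
  \<comment> \<open>One label per cell: dominance of both endpoints on each cell then fixes their
    coordinates, since both have the first moment of that cell.\<close>
  define Js where "Js = map (\<lambda>k. {\<tau> k}) [0..<length Ps]"
  have "matched (($) v) (($) B) (Ps ! k) {\<tau> k}" if "k < length Ps" for k
    using has_volumes_barycentersD[OF v vb, of "\<tau> k"] \<tau>[OF that] by (simp add: matched_def Ps(3))
  then have "list_all2 (matched (($) v) (($) B)) Ps Js"
    by (simp add: list_all2_conv_all_nth Js_def)
  moreover have "sorted_wrt (\<lambda>A B. A \<inter> B = {}) Js"
    unfolding sorted_wrt_iff_nth_less
  proof (intro allI impI)
    fix k l assume kl: "k < l" "l < length Js"
    then have "\<tau> k \<noteq> \<tau> l" using \<tau>[of k] \<tau>[of l] by (auto simp: Js_def)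
    then show "Js ! k \<inter> Js ! l = {}" using kl by (simp add: Js_def)
  qed
  moreover have "\<Union>(set Js) = UNIV"
    unfolding Js_def using \<sigma> by (auto intro!: bexI[of _ "\<sigma> _"])
  ultimately have dom: "list_all2 (\<lambda>P J. dominated (($) v) P J (($) B') \<and> dominated (($) v) P J (($) B'')) Ps Js"
    using v t Ps(1) dominated_barycentersD[OF less_imp_le[OF v] B']
      dominated_barycentersD[OF less_imp_le[OF v] B'']
    by (intro dominated_hierarchical_cells[where t = t and b = "($) B"]) (auto simp: less_imp_le)
  have "B' $ i = B'' $ i" for i
  proof -
    have "dominated (($) v) (L i) {i} (($) B')" "dominated (($) v) (L i) {i} (($) B'')"
      using list_all2_nthD[OF dom \<sigma>(2)[of i]] \<sigma> by (auto simp: Js_def Ps(3))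
    moreover have "L i \<in> sets borel"
      using hierarchical_cells_borel[OF Ps(1)] \<sigma>(2) Ps(3) by auto
    ultimately have "(\<Sum>j\<in>{i}. v $ j *\<^sub>R B' $ j) = (\<Sum>j\<in>{i}. v $ j *\<^sub>R B'' $ j)"
      by (simp only: dominated_barycenter)
    then show ?thesis using v[of i] by simp
  qed
  then show False using \<open>B' \<noteq> B''\<close> by (simp add: vec_eq_iff)
qed

lemma closure_B_Lag_subset_B_hLag:
  assumes v: "\<And>i. 0 < v $ i"
  shows "closure (B_Lag v \<rho>) \<subseteq> B_hLag v \<rho>"
proof
  fix B assume "B \<in> closure (B_Lag v \<rho>)"
  then obtain C where C: "\<And>n. C n \<in> B_Lag v \<rho>" "C \<longlonglongrightarrow> B"
    unfolding closure_sequential by blast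
  have "\<forall>n. \<exists>y \<phi>. inj y \<and> has_volumes_barycenters v \<rho> (laguerre_cell UNIV y \<phi>) (C n)"
  proof
    fix n
    obtain L y \<phi> where "inj y" "\<And>i. L i = laguerre_cell UNIV y \<phi> i"
      "has_volumes_barycenters v \<rho> L (C n)"
      using C(1)[of n] unfolding B_Lag_def laguerre_tessellation_def by blast
    moreover from this have "L = laguerre_cell UNIV y \<phi>" by auto
    ultimately show "\<exists>y \<phi>. inj y \<and> has_volumes_barycenters v \<rho> (laguerre_cell UNIV y \<phi>) (C n)"
      by blast
  qed
  then obtain y \<phi> where y: "\<And>n. inj (y n)"
    and vb: "\<And>n. has_volumes_barycenters v \<rho> (laguerre_cell UNIV (y n) (\<phi> n)) (C n)"
    by metis
  \<comment> \<open>All tessellations in the sequence have the volumes \<open>v\<close>, so this is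
    the uniform mass bound for the compactness argument.\<close>
  define c where "c = Min (range (($) v))"
  have c: "0 < c" "c \<le> v $ i" for i
    unfolding c_def using v by auto
  obtain r P where r: "strict_mono r" "hierarchical_on UNIV P"
    and lim: "AE x in \<rho>. \<forall>i. \<forall>\<^sub>F n in sequentially.
      x \<in> laguerre_cell UNIV (y (r n)) (\<phi> (r n)) i \<longleftrightarrow> x \<in> P i"
    using laguerre_cells_limit[of UNIV y UNIV c \<phi>] y c has_volumes_barycentersD(1)[OF v vb]
    by auto
  obtain ks where "set ks = UNIV" "hierarchical_cells (map P ks)"
    using r(2) unfolding hierarchical_on_def by blast
  then have P: "P i \<in> sets borel" for i using hierarchical_cells_borel by force
  have lim_i: "AE x in \<rho>. \<forall>\<^sub>F n in sequentially.
      x \<in> laguerre_cell UNIV (y (r n)) (\<phi> (r n)) i \<longleftrightarrow> x \<in> P i" for i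
    using lim by eventually_elim simp
  have "measure \<rho> (P i) = v $ i" for i
    using measure_tendsto[OF laguerre_cell_borel P lim_i] has_volumes_barycentersD(1)[OF v vb]
    by (simp add: LIMSEQ_const_iff)
  moreover have "(LINT x:P i|\<rho>. x) = v $ i *\<^sub>R B $ i" for i
  proof (rule LIMSEQ_unique)
    have "(\<lambda>n. LINT x:laguerre_cell UNIV (y (r n)) (\<phi> (r n)) i|\<rho>. x) \<longlonglongrightarrow> (LINT x:P i|\<rho>. x)"
      by (rule set_integral_tendsto[OF integrable_ident laguerre_cell_borel P lim_i])
    then show "(\<lambda>n. v $ i *\<^sub>R C (r n) $ i) \<longlonglongrightarrow> (LINT x:P i|\<rho>. x)"
      using has_volumes_barycentersD(2)[OF v vb] by simp
    show "(\<lambda>n. v $ i *\<^sub>R C (r n) $ i) \<longlonglongrightarrow> v $ i *\<^sub>R B $ i"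
      using LIMSEQ_subseq_LIMSEQ[OF C(2) r(1)]
      by (intro tendsto_intros) (simp add: comp_def)
  qed
  ultimately have "has_volumes_barycenters v \<rho> P B"
    using v by (auto simp: has_volumes_barycenters_def less_imp_neq[symmetric])
  then show "B \<in> B_hLag v \<rho>"
    using hierarchical_on_UNIV[OF r(2)] unfolding B_hLag_def by blast
qed

text \<open>Makes the closure compact. In finite dimension its convex hull is then closed, so points
  outside the hull can be strictly separated.\<close>

lemma bounded_B_Lag:
  assumes v: "\<And>i. 0 < v $ i"
  shows "bounded (B_Lag v \<rho>)"
proof (rule boundedI)
  fix B assume "B \<in> B_Lag v \<rho>"
  then obtain L where L: "laguerre_tessellation UNIV L" "has_volumes_barycenters v \<rho> L B"
    unfolding B_Lag_def by blast
  have L_borel: "L i \<in> sets borel" for i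
    using L(1) unfolding laguerre_tessellation_def by auto
  have "norm (B $ i) \<le> (LINT x|\<rho>. norm x) / v $ i" for i
  proof -
    have int: "integrable \<rho> (\<lambda>x. indicator (L i) x *\<^sub>R x)"
      using set_integrable_borel[OF integrable_ident L_borel] by (simp add: set_integrable_def)
    have "norm (v $ i *\<^sub>R B $ i) \<le> (LINT x|\<rho>. norm (indicator (L i) x *\<^sub>R x))"
      unfolding has_volumes_barycentersD(2)[OF v L(2)] set_lebesgue_integral_def
      by (rule integral_norm_bound)
    also have "\<dots> \<le> (LINT x|\<rho>. norm x)"
      by (rule integral_mono[OF integrable_norm[OF int]]) (auto simp: indicator_def)
    finally show ?thesis using v[of i] by (simp add: pos_le_divide_eq mult.commute)
  qed
  then have "(\<Sum>i\<in>UNIV. norm (B $ i)) \<le> (\<Sum>i\<in>UNIV. (LINT x|\<rho>. norm x) / v $ i)"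
    by (rule sum_mono)
  moreover have "norm B \<le> (\<Sum>i\<in>UNIV. norm (B $ i))"
    unfolding norm_vec_def by (rule L2_set_le_sum) simp
  ultimately show "norm B \<le> (\<Sum>i\<in>UNIV. (LINT x|\<rho>. norm x) / v $ i)" by simp
qed

text \<open>The maximum of the affine functions is tested against \<open>B\<close>; for
  \<open>b\<close> the inequality is an equality cell by cell. The weights contribute \<Sum> v_i
  \<phi>_i to both sides and cancel.\<close>

lemma B_Lag_maximizes:
  assumes v: "\<And>i. 0 < v $ i" and y: "inj y"
    and vb: "has_volumes_barycenters v \<rho> (laguerre_cell UNIV y \<phi>) b"
    and B: "B \<in> dominated_barycenters v \<rho>"
  shows "(\<Sum>i\<in>UNIV. v $ i * (B $ i \<bullet> y i)) \<le> (\<Sum>i\<in>UNIV. v $ i * (b $ i \<bullet> y i))"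
proof -
  define m where "m x = Max (range (\<lambda>i. x \<bullet> y i - \<phi> i))" for x
  have m: "convex_on UNIV m" "integrable \<rho> m"
    unfolding m_def using convex_on_inner_right
    by (intro convex_on_Max integrable_Max; auto)+
  have "(\<Sum>i\<in>UNIV. v $ i * (B $ i \<bullet> y i - \<phi> i)) \<le> (\<Sum>i\<in>UNIV. v $ i * m (B $ i))"
    unfolding m_def using v by (intro sum_mono mult_left_mono Max_ge) (auto simp: less_imp_le)
  also have "\<dots> \<le> (LINT x:UNIV|\<rho>. m x)"
    using dominated_barycentersD[OF less_imp_le[OF v] B] m unfolding dominated_def by blast
  also have "\<dots> = (\<Sum>i\<in>UNIV. LINT x:UNIV \<inter> laguerre_cell UNIV y \<phi> i|\<rho>. m x)"
    using y m(2) by (intro set_integral_split_cells) auto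
  also have "\<dots> = (\<Sum>i\<in>UNIV. LINT x:laguerre_cell UNIV y \<phi> i|\<rho>. x \<bullet> y i - \<phi> i)"
    unfolding m_def
    by (intro sum.cong refl) (auto intro!: set_lebesgue_integral_cong Max_on_laguerre_cell)
  also have "\<dots> = (\<Sum>i\<in>UNIV. v $ i * (b $ i \<bullet> y i - \<phi> i))"
    using has_volumes_barycentersD[OF v vb]
    by (intro sum.cong refl)
      (simp add: set_integral_affine right_diff_distrib mult.commute flip: has_volumes_barycentersD(2)[OF v vb])
  finally show ?thesis by (simp add: right_diff_distrib sum_subtractf)
qed

lemma dominated_subset_hull_B_Lag:
  assumes v: "\<And>i. 0 < v $ i" "(\<Sum>i\<in>UNIV. v $ i) = 1"
  shows "dominated_barycenters v \<rho> \<subseteq> convex hull (closure (B_Lag v \<rho>))"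
proof (rule subsetI, rule ccontr)
  fix B assume B: "B \<in> dominated_barycenters v \<rho>"
    and "B \<notin> convex hull (closure (B_Lag v \<rho>))"
  moreover have "compact (closure (B_Lag v \<rho>))"
    using bounded_B_Lag[OF v(1)] by (simp add: compact_closure)
  then have "closed (convex hull (closure (B_Lag v \<rho>)))"
    by (intro compact_imp_closed compact_convex_hull)
  ultimately obtain a \<beta> where a: "a \<bullet> B < \<beta>"
    "\<And>b. b \<in> convex hull (closure (B_Lag v \<rho>)) \<Longrightarrow> \<beta> < a \<bullet> b"
    using separating_hyperplane_closed_point[of "convex hull (closure (B_Lag v \<rho>))" B]
    by (auto simp: convex_convex_hull)
  obtain R where R: "\<And>b. b \<in> B_Lag v \<rho> \<Longrightarrow> norm b \<le> R"
    using bounded_B_Lag[OF v(1)] unfolding bounded_iff by blast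
  obtain e :: "'b \<Rightarrow> 'a" where e: "inj e" using exists_inj_finite_euclidean by blast
  define E where "E = (\<chi> i. v $ i *\<^sub>R e i)"
  \<comment> \<open>A bound for the effect of the perturbation direction \<open>E\<close> on the
    difference between a Laguerre barycenter and \<open>B\<close>; the summand 1 makes it positive,
    so \<open>t\<close> can be taken below the separation gap divided by \<open>K\<close>.\<close>
  define K where "K = \<bar>norm E * R\<bar> + \<bar>E \<bullet> B\<bar> + 1"
  have K: "0 < K" unfolding K_def by simp
  have "0 < (\<beta> - a \<bullet> B) / K" using a(1) K by simp
  from exists_inj_perturbation[OF e this, of "\<lambda>i. - (a $ i /\<^sub>R v $ i)"]
  obtain t where t: "0 < t" "t < (\<beta> - a \<bullet> B) / K"
    and inj: "inj (\<lambda>i. - (a $ i /\<^sub>R v $ i) + t *\<^sub>R e i)" by blast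
  \<comment> \<open>The first summand represents the linear form \<open>- a\<close> in the pairing
    weighted by \<open>v\<close>. These vectors may coincide, and the second summand makes them
    distinct.\<close>
  define y where "y i = - (a $ i /\<^sub>R v $ i) + t *\<^sub>R e i" for i
  have y: "inj y" using inj unfolding y_def .
  obtain \<phi> where \<phi>: "\<And>i. measure \<rho> (laguerre_cell UNIV y \<phi> i) = v $ i"
    using laguerre_volumes_exist[OF y v] by blast
  define b where "b = (\<chi> i. (1 / v $ i) *\<^sub>R (LINT x:laguerre_cell UNIV y \<phi> i|\<rho>. x))"
  have vb: "has_volumes_barycenters v \<rho> (laguerre_cell UNIV y \<phi>) b"
    using \<phi> unfolding has_volumes_barycenters_def b_def by simp
  have b: "b \<in> B_Lag v \<rho>"
    using vb y unfolding B_Lag_def laguerre_tessellation_def by blast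
  have pairing: "(\<Sum>i\<in>UNIV. v $ i * (C $ i \<bullet> y i)) = t * (E \<bullet> C) - a \<bullet> C" for C
  proof -
    have "v $ i * (C $ i \<bullet> y i) = t * (E $ i \<bullet> C $ i) - a $ i \<bullet> C $ i" for i
      using v(1)[of i] unfolding y_def E_def
      by (simp add: inner_add_right inner_commute algebra_simps)
    then show ?thesis
      by (simp add: inner_vec_def sum_subtractf sum_distrib_left)
  qed
  have "t * (E \<bullet> B) - a \<bullet> B \<le> t * (E \<bullet> b) - a \<bullet> b"
    using B_Lag_maximizes[OF v(1) y vb B] unfolding pairing .
  then have "a \<bullet> b - a \<bullet> B \<le> t * (E \<bullet> b - E \<bullet> B)" by (simp add: right_diff_distrib)
  also have "\<dots> \<le> t * K"
  proof (rule mult_left_mono)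
    have "E \<bullet> b \<le> norm E * norm b" by (rule norm_cauchy_schwarz)
    also have "\<dots> \<le> norm E * R" using R[OF b] by (rule mult_left_mono) simp
    finally show "E \<bullet> b - E \<bullet> B \<le> K" unfolding K_def by linarith
  qed (use t in simp)
  also have "\<dots> < \<beta> - a \<bullet> B" using t(2) K by (simp add: pos_less_divide_eq)
  finally have "a \<bullet> b < \<beta>" by simp
  moreover have "b \<in> convex hull (closure (B_Lag v \<rho>))"
    using b closure_subset hull_inc by (metis subsetD)
  ultimately show False using a(2) by fastforce
qed

text \<open>Since the dominated set equals the convex hull itself, an extreme point cannot be a
  proper convex combination and must belong to the generating closure.\<close>

lemma extreme_subset_closure_B_Lag:
  assumes v: "\<And>i. 0 < v $ i" "(\<Sum>i\<in>UNIV. v $ i) = 1"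
    and B: "B extreme_point_of dominated_barycenters v \<rho>"
  shows "B \<in> closure (B_Lag v \<rho>)"
proof -
  have "closure (B_Lag v \<rho>) \<subseteq> dominated_barycenters v \<rho>"
    using closure_B_Lag_subset_B_hLag[OF v(1)] B_hLag_subset_dominated[OF v(1)] by blast
  then have "convex hull (closure (B_Lag v \<rho>)) \<subseteq> dominated_barycenters v \<rho>"
    using convex_dominated_barycenters[OF less_imp_le[OF v(1)]] by (rule hull_minimal)
  then have "convex hull (closure (B_Lag v \<rho>)) = dominated_barycenters v \<rho>"
    using dominated_subset_hull_B_Lag[OF v] by blast
  then show ?thesis using B extreme_point_of_convex_hull by metis
qed

end

lemma hyperplane_null_measureI:
  assumes "\<rho> \<in> P1" "has_bounded_density \<rho>"
  shows "hyperplane_null_measure \<rho>"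
proof -
  interpret prob_space \<rho> using assms(1) unfolding P1_def by simp
  show ?thesis
  proof
    show sets: "sets \<rho> = sets borel" using assms(1) unfolding P1_def by simp
    have "(\<lambda>x. x) \<in> borel_measurable \<rho>" using sets by (simp add: measurable_ident_sets)
    then show "integrable \<rho> (\<lambda>x. x)"
      using assms(1) unfolding P1_def by (simp add: integrable_norm_iff)
    fix a :: 'a and c :: real assume "a \<noteq> 0"
    then have "negligible {x. a \<bullet> x = c}" by (intro negligible_hyperplane) simp
    then have "AE x in lebesgue. x \<bullet> a \<noteq> c"
      using AE_not_in[of "{x. a \<bullet> x = c}" lebesgue]
      by (simp add: negligible_iff_null_sets inner_commute)
    then have "AE x in lborel. x \<bullet> a \<noteq> c" by (simp add: AE_completion_iff)
    then show "AE x in \<rho>. x \<bullet> a \<noteq> c"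
      using assms(2) unfolding has_bounded_density_def by (auto simp: AE_density)
  qed
qed

theorem theorem3p9:
  fixes \<rho> :: "(real ^ 'd) measure" and v :: "real ^ 'n"
  assumes "\<rho> \<in> P1"
    and "has_bounded_density \<rho>"
    and "\<forall>i. v $ i > 0"
    and "(\<Sum>i\<in>UNIV. v $ i) = 1"
  shows "B_hLag v \<rho> = closure (B_Lag v \<rho>) \<and>
    B_hLag v \<rho> = {B. B extreme_point_of dominated_barycenters v \<rho>}"
proof -
  interpret hyperplane_null_measure \<rho>
    using assms(1,2) by (rule hyperplane_null_measureI)
  have v: "0 < v $ i" for i using assms(3) by simp
  \<comment> \<open>The three inclusions form a cycle, so both equalities follow at once.\<close>
  show ?thesis
    using closure_B_Lag_subset_B_hLag[OF v] B_hLag_extreme[OF v]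
      extreme_subset_closure_B_Lag[OF v assms(4)]
    by blast
qed

end
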